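(* Let $d\ge1$, let $\|\cdot\|$ be any norm on $\mathbb{R}^d$, and let $f:\mathbb{R}^d\to\mathbb{R}$ be a probability density function that is bounded and almost everywhere continuous. For each $n$ let $R_n$ be a positive random variable having a density function $q_n$, with $E R_n^d\to0$ as $n\to\infty$. Let $T$ be a single vertex, and let $\tilde G_{n,T}$ be the number of isolated $T$-subgraphs of $G(\mathcal{X}_n,\mathcal{R}_n)$, i.e. the number of vertices of $G(\mathcal{X}_n,\mathcal{R}_n)$ from which no arc leaves. Suppose $nR_n^d\to\lambda\in[0,\infty)$ in probability (with $\lambda$ a constant). Then $$\lim_{n\to\infty}n^{-1}\tilde G_{n,T}=\int_{\mathbb{R}^d}e^{-\theta\lambda f(x)}f(x)\,\mathrm{d}x\quad\text{almost surely},$$ where $\theta:=|B(0,1)|$ is the Lebesgue measure of the unit ball of $\|\cdot\|$.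
   Context: Random model: $X_1,X_2,\dots$ are i.i.d. random vectors in $\mathbb{R}^d$ with density $f$, and $\mathcal{X}_n=\{X_1,\dots,X_n\}$. For each $n$, $R_{n,1},\dots,R_{n,n}$ are independent copies of $R_n$, independent of the $X_i$, and $\mathcal{R}_n=\{R_{n,1},\dots,R_{n,n}\}$. $B(x,r)=\{z\in\mathbb{R}^d:\|z-x\|<r\}$. The digraph $G(\mathcal{X}_n,\mathcal{R}_n)$ has vertex set $\mathcal{X}_n$ and an arc $(X_i,X_j)$ from $X_i$ to $X_j$, $i\neq j$, if and only if $X_j\in B(X_i,R_{n,i})$. Isolated subgraph: a subgraph $H$ of a digraph $G$ is isolated if it is an induced subgraph and no arc of $G$ leaves $H$ (no arc goes from a vertex of $H$ to a vertex outside $H$); incoming arcs are allowed. *)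

theory Defs
  imports "Graph_Theory.Digraph_Isomorphism" "HOL-Probability.Probability"
begin

definition is_norm :: "('a::real_vector \<Rightarrow> real) \<Rightarrow> bool" where
  "is_norm N \<longleftrightarrow>
     (\<forall>x. 0 \<le> N x) \<and>
     (\<forall>x. N x = 0 \<longleftrightarrow> x = 0) \<and>
     (\<forall>c x. N (c *\<^sub>R x) = \<bar>c\<bar> * N x) \<and>
     (\<forall>x y. N (x + y) \<le> N x + N y)"

definition norm_ball :: "('a::real_vector \<Rightarrow> real) \<Rightarrow> 'a \<Rightarrow> real \<Rightarrow> 'a set" where
  "norm_ball N x r = {z. N (z - x) < r}"

text \<open>
  The digraph on the points \<open>x 1, \<dots>, x n\<close>, where the \<open>i\<close>-th point has radius \<open>r i\<close>.  The
  vertices are the points themselves, not their indices; if some of the points coincide, they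
  are identified (for i.i.d. points with a density this has probability zero).
\<close>

definition geometric_digraph ::
  "('a::real_vector \<Rightarrow> real) \<Rightarrow> nat \<Rightarrow> (nat \<Rightarrow> 'a) \<Rightarrow> (nat \<Rightarrow> real) \<Rightarrow> ('a, 'a \<times> 'a) pre_digraph" where
  "geometric_digraph N n x r =
     \<lparr>verts = x ` {1..n},
      arcs = {(x i, x j) | i j.
                i \<in> {1..n} \<and> j \<in> {1..n} \<and> i \<noteq> j \<and> x j \<in> norm_ball N (x i) (r i)},
      tail = fst, head = snd\<rparr>"

text \<open>Arcs may enter \<open>H\<close> from outside; only arcs leaving \<open>H\<close> are forbidden.\<close>

definition isolated_subgraph :: "('a, 'b) pre_digraph \<Rightarrow> ('a, 'b) pre_digraph \<Rightarrow> bool" where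
  "isolated_subgraph H G \<longleftrightarrow>
     induced_subgraph H G \<and>
     \<not> (\<exists>e \<in> arcs G. tail G e \<in> verts H \<and> head G e \<notin> verts H)"

definition num_isolated :: "('c, 'd) pre_digraph \<Rightarrow> ('a, 'b) pre_digraph \<Rightarrow> nat" where
  "num_isolated T G = card {H. isolated_subgraph H G \<and> digraph_iso H T}"

definition single_vertex :: "(unit, unit) pre_digraph" where
  "single_vertex = \<lparr>verts = {()}, arcs = {}, tail = (\<lambda>_. ()), head = (\<lambda>_. ())\<rparr>"

definition tends_in_prob :: "'w measure \<Rightarrow> (nat \<Rightarrow> 'w \<Rightarrow> real) \<Rightarrow> real \<Rightarrow> bool" where
  "tends_in_prob M Y c \<longleftrightarrow>
     (\<forall>\<epsilon>>0. (\<lambda>n. measure M {\<omega> \<in> space M. \<bar>Y n \<omega> - c\<bar> > \<epsilon>}) \<longlonglongrightarrow> 0)"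

text \<open>
  Independence of two random elements with values in different types; the library's
  \<open>indep_var\<close> requires both to take values in the same type.
\<close>

definition indep_pair ::
  "'w measure \<Rightarrow> 'a measure \<Rightarrow> ('w \<Rightarrow> 'a) \<Rightarrow> 'b measure \<Rightarrow> ('w \<Rightarrow> 'b) \<Rightarrow> bool" where
  "indep_pair M S U T V \<longleftrightarrow>
     U \<in> measurable M S \<and> V \<in> measurable M T \<and>
     prob_space.indep_set M {U -` A \<inter> space M | A. A \<in> sets S} {V -` B \<inter> space M | B. B \<in> sets T}"

lemma wf_geometric_digraph: "wf_digraph (geometric_digraph N n x r)"
  by unfold_locales (auto simp: geometric_digraph_def)

lemma digraph_iso_single_vertex_iff:
  assumes "wf_digraph H"
  shows "digraph_iso H single_vertex \<longleftrightarrow> (\<exists>v. verts H = {v}) \<and> arcs H = {}"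
proof
  assume "digraph_iso H single_vertex"
  then obtain h where h: "pre_digraph.digraph_isomorphism H h" "single_vertex = app_iso h H"
    by (auto simp: digraph_iso_def)
  have inj: "inj_on (iso_verts h) (verts H)"
    using h(1) by (simp add: pre_digraph.digraph_isomorphism_def)
  have img: "iso_verts h ` verts H = {()}"
    using arg_cong[OF h(2), of verts] by (simp add: single_vertex_def app_iso_def)
  have "arcs H = {}"
    using arg_cong[OF h(2), of arcs] by (simp add: single_vertex_def app_iso_def)
  moreover have "card (verts H) = 1"
    using card_image[OF inj] unfolding img by simp
  ultimately show "(\<exists>v. verts H = {v}) \<and> arcs H = {}"
    by (auto simp: card_1_singleton_iff)
next
  assume H: "(\<exists>v. verts H = {v}) \<and> arcs H = {}"
  let ?h = "\<lparr>iso_verts = \<lambda>_. (), iso_arcs = \<lambda>_. (), iso_head = \<lambda>_. (), iso_tail = \<lambda>_. ()\<rparr>"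
  have "pre_digraph.digraph_isomorphism H ?h"
    using H assms by (auto simp: pre_digraph.digraph_isomorphism_def)
  moreover have "single_vertex = app_iso ?h H"
    using H by (auto simp: single_vertex_def app_iso_def)
  ultimately show "digraph_iso H single_vertex"
    by (auto simp: digraph_iso_def)
qed

lemma num_isolated_single_vertex:
  assumes "wf_digraph G"
  shows "num_isolated single_vertex G = card {v \<in> verts G. \<forall>e \<in> arcs G. tail G e \<noteq> v}"
proof -
  let ?f = "\<lambda>v. \<lparr>verts = {v}, arcs = {}, tail = tail G, head = head G\<rparr>"
  let ?V = "{v \<in> verts G. \<forall>e \<in> arcs G. tail G e \<noteq> v}"
  have "{H. isolated_subgraph H G \<and> digraph_iso H single_vertex} = ?f ` ?V" (is "?L = _")
  proof (intro set_eqI iffI)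
    fix H assume "H \<in> ?L"
    then have iso: "isolated_subgraph H G" "digraph_iso H single_vertex" by auto
    then have ind: "induced_subgraph H G" and sub: "subgraph H G" and wf: "wf_digraph H"
      by (auto simp: isolated_subgraph_def induced_subgraph_def subgraph_def)
    obtain v where v: "verts H = {v}" "arcs H = {}"
      using iso(2) digraph_iso_single_vertex_iff[OF wf] by auto
    have "v \<in> ?V"
      using v ind sub iso(1)
      by (auto simp: isolated_subgraph_def induced_subgraph_def subgraph_def)
    moreover have "H = ?f v"
      using v sub by (auto simp: subgraph_def compatible_def)
    ultimately show "H \<in> ?f ` ?V" by blast
  next
    fix H assume "H \<in> ?f ` ?V"
    then obtain v where v: "v \<in> ?V" "H = ?f v" by blast
    have wf: "wf_digraph H"
      using v by (auto simp: wf_digraph_def)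
    have "isolated_subgraph H G"
      using v wf assms
      by (auto simp: isolated_subgraph_def induced_subgraph_def subgraph_def compatible_def)
    then show "H \<in> ?L"
      using v(2) digraph_iso_single_vertex_iff[OF wf] by simp
  qed
  moreover have "inj_on ?f ?V" by (auto simp: inj_on_def)
  ultimately show ?thesis
    by (simp add: num_isolated_def card_image)
qed

end

theory Submission
  imports Defs "HOL-Real_Asymp.Real_Asymp"
begin

text \<open>
  Since \<open>n R\<^sub>n^d\<close> concentrates at the constant \<open>\<lambda>\<close>, only \<open>o(n)\<close> of the radii \<open>R\<^sub>n\<^sub>,\<^sub>i\<close> lie outside
  the interval between \<open>((\<lambda> - \<delta>)/n)^(1/d)\<close> and \<open>((\<lambda> + \<delta>)/n)^(1/d)\<close>; by Hoeffding's inequality and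
  Borel--Cantelli this holds almost surely, however the rows are coupled.  Hence the count is
  squeezed, up to \<open>o(n)\<close>, between the numbers of isolated vertices of two geometric graphs on the
  same points with deterministic radius \<open>(t/n)^(1/d)\<close>.  For these, points at distance at least twice the
  radius have disjoint balls, so the corresponding isolation events are nearly negatively correlated
  and the variance of the normalised count is \<open>O(1/n)\<close>.  This gives almost sure convergence along
  \<open>n = k\<^sup>2\<close>, and monotonicity in the radius and in the number of points fills the gaps.  The
  expectation converges by dominated convergence, and the limit is continuous in \<open>t\<close>, so \<open>\<delta>\<close> may
  tend to \<open>0\<close>.
\<close>

section \<open>Norms on Euclidean space and their balls\<close>

lemma is_normD:
  assumes "is_norm N"
  shows "0 \<le> N x" "N x = 0 \<longleftrightarrow> x = 0" "N (c *\<^sub>R x) = \<bar>c\<bar> * N x" "N (x + y) \<le> N x + N y"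
  using assms by (auto simp: is_norm_def)

lemma is_norm_minus_commute:
  assumes "is_norm N" shows "N (x - y) = N (y - x)"
  using is_normD(3)[OF assms, of "-1" "x - y"] by simp

text \<open>Expanding \<open>x\<close> in the orthonormal basis reduces this to the triangle
  inequality, since no coordinate exceeds \<open>norm x\<close> in absolute value.\<close>

lemma is_norm_le_norm:
  fixes N :: "'a::euclidean_space \<Rightarrow> real"
  assumes N: "is_norm N"
  shows "N x \<le> (\<Sum>b\<in>Basis. N b) * norm x"
proof -
  have sub: "N (sum g S) \<le> (\<Sum>b\<in>S. N (g b))" if "finite S" for g :: "'a \<Rightarrow> 'a" and S
    using that
  proof induction
    case empty
    then show ?case using is_normD(2)[OF N, of 0] by simp
  next
    case (insert a S)
    then show ?case using is_normD(4)[OF N, of "g a" "sum g S"] by simp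
  qed
  have "N x = N (\<Sum>b\<in>Basis. (x \<bullet> b) *\<^sub>R b)"
    by (simp add: euclidean_representation)
  also have "\<dots> \<le> (\<Sum>b\<in>Basis. N ((x \<bullet> b) *\<^sub>R b))"
    by (rule sub) simp
  also have "\<dots> \<le> (\<Sum>b\<in>Basis. N b * norm x)"
    by (intro sum_mono) (simp add: is_normD(1,3)[OF N] mult.commute[of _ "N _"] mult_left_mono Basis_le_norm)
  finally show ?thesis by (simp add: sum_distrib_right)
qed

text \<open>The reverse triangle inequality and the bound by the Euclidean norm make
  \<open>N\<close> Lipschitz.\<close>

lemma is_norm_continuous_on:
  fixes N :: "'a::euclidean_space \<Rightarrow> real"
  assumes N: "is_norm N"
  shows "continuous_on A N"
proof -
  let ?K = "\<Sum>b\<in>Basis. N b"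
  have diff: "N x - N y \<le> ?K * dist x y" for x y
    using is_normD(4)[OF N, of "x - y" y] is_norm_le_norm[OF N, of "x - y"]
    by (simp add: dist_norm)
  have "?K-lipschitz_on A N"
  proof (intro lipschitz_onI)
    show "dist (N x) (N y) \<le> ?K * dist x y" for x y
      using diff[of x y] diff[of y x] by (simp add: dist_real_def abs_le_iff dist_commute)
  qed (intro sum_nonneg is_normD(1)[OF N])
  then show ?thesis by (rule lipschitz_on_continuous_on)
qed

lemma is_norm_borel_measurable [measurable]:
  fixes N :: "'a::euclidean_space \<Rightarrow> real"
  assumes "is_norm N"
  shows "N \<in> borel_measurable borel"
  using is_norm_continuous_on[OF assms] by (rule borel_measurable_continuous_onI)

text \<open>By compactness \<open>N\<close> attains its minimum on the Euclidean unit sphere; this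
  minimum is positive, and homogeneity extends the bound to all vectors. Hence
  \<open>N\<close>-balls sit inside Euclidean balls of comparable radius.\<close>

lemma is_norm_ge_norm:
  fixes N :: "'a::euclidean_space \<Rightarrow> real"
  assumes N: "is_norm N"
  obtains c where "0 < c" "\<And>x. c * norm x \<le> N x"
proof -
  obtain b :: 'a where "b \<in> Basis" by (meson nonempty_Basis all_not_in_conv)
  then have "sphere (0::'a) 1 \<noteq> {}" by (auto intro!: exI[of _ b])
  then obtain y where y: "y \<in> sphere 0 1" "\<And>z. z \<in> sphere 0 1 \<Longrightarrow> N y \<le> N z"
    using continuous_attains_inf[OF compact_sphere _ is_norm_continuous_on[OF N], of 0 1] by blast
  have "N y > 0"
    using is_normD(1,2)[OF N, of y] y(1) by (auto simp: less_le)
  moreover have "N y * norm x \<le> N x" for x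
  proof (cases "x = 0")
    case False
    then have "N y \<le> N ((1 / norm x) *\<^sub>R x)" by (intro y(2)) simp
    then show ?thesis using False by (simp only: is_normD(3)[OF N]) (simp add: field_simps)
  qed (simp add: is_normD(1)[OF N])
  ultimately show ?thesis using that by blast
qed

lemma norm_ball_borel [measurable]:
  fixes N :: "'a::euclidean_space \<Rightarrow> real"
  assumes "is_norm N"
  shows "norm_ball N x r \<in> sets borel"
  using is_norm_borel_measurable[OF assms] unfolding norm_ball_def by measurable

lemma emeasure_norm_ball_finite:
  fixes N :: "'a::euclidean_space \<Rightarrow> real"
  assumes N: "is_norm N"
  shows "emeasure lborel (norm_ball N x r) < \<infinity>"
proof -
  obtain c where c: "0 < c" "\<And>x. c * norm x \<le> N x" using is_norm_ge_norm[OF N] by blast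
  have "norm_ball N x r \<subseteq> ball x (r / c)"
  proof
    fix z assume "z \<in> norm_ball N x r"
    then have "c * norm (z - x) < r" using c(2)[of "z - x"] by (simp add: norm_ball_def)
    then show "z \<in> ball x (r / c)"
      using c(1) by (simp add: dist_norm norm_minus_commute field_simps)
  qed
  then show ?thesis
    using bounded_subset[OF bounded_ball] emeasure_bounded_finite by blast
qed

text \<open>The ball is the image of the unit ball under an affine map with factor \<open>r\<close>.
  That change of variables needs a nonzero \<open>r\<close>; for \<open>r = 0\<close> the ball is
  empty and the right side vanishes because the dimension is positive.\<close>

lemma measure_norm_ball:
  fixes N :: "'a::euclidean_space \<Rightarrow> real"
  assumes N: "is_norm N" and "0 \<le> r"
  shows "measure lborel (norm_ball N x r) = measure lborel (norm_ball N 0 1) * r ^ DIM('a)"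
proof (cases "r = 0")
  case True
  then show ?thesis using is_normD(1)[OF N] by (auto simp: norm_ball_def not_less[symmetric])
next
  case False
  with \<open>0 \<le> r\<close> have r: "0 < r" by simp
  have pre: "(\<lambda>z. x + r *\<^sub>R z) -` norm_ball N x r = norm_ball N 0 1"
    using r by (auto simp: norm_ball_def is_normD(3)[OF N])
  have "emeasure lborel (norm_ball N x r)
      = ennreal (r ^ DIM('a)) * emeasure lborel (norm_ball N 0 1)"
    using r norm_ball_borel[OF N]
    by (subst lborel_affine[of r x]) (simp_all add: emeasure_density nn_integral_cmult
        nn_integral_distr pre emeasure_distr)
  then show ?thesis
    using r by (simp add: measure_def enn2real_mult mult.commute)
qed

section \<open>Bounds for densities and an exponential limit\<close>

lemma measure_density_ge:
  assumes [measurable]: "f \<in> borel_measurable M" "A \<in> sets M"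
    and "emeasure M A < \<infinity>" "emeasure (density M (\<lambda>x. ennreal (f x))) A < \<infinity>"
    and "\<And>z. z \<in> A \<Longrightarrow> a \<le> f z"
  shows "a * measure M A \<le> measure (density M (\<lambda>x. ennreal (f x))) A"
proof (cases "0 \<le> a")
  case True
  have "ennreal a * emeasure M A = (\<integral>\<^sup>+z. ennreal a * indicator A z \<partial>M)"
    by (simp add: nn_integral_cmult_indicator)
  also have "\<dots> \<le> (\<integral>\<^sup>+z. ennreal (f z) * indicator A z \<partial>M)"
    using assms(5) by (intro nn_integral_mono) (auto simp: indicator_def intro: ennreal_leI)
  also have "\<dots> = emeasure (density M (\<lambda>x. ennreal (f x))) A"
    by (simp add: emeasure_density)
  finally show ?thesis
    using assms(3,4) True
    by (simp add: emeasure_eq_ennreal_measure less_top ennreal_mult[symmetric])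
next
  case False
  \<comment> \<open>Negative \<open>a\<close> can occur: the bound is applied with
    \<open>a = f x - \<epsilon>\<close>.\<close>
  then have "a * measure M A \<le> 0" by (simp add: mult_nonpos_nonneg)
  then show ?thesis by (rule order_trans) simp
qed

lemma measure_density_le:
  assumes [measurable]: "f \<in> borel_measurable M" "A \<in> sets M"
    and "emeasure M A < \<infinity>" "0 \<le> b"
    and "\<And>z. z \<in> A \<Longrightarrow> f z \<le> b"
  shows "measure (density M (\<lambda>x. ennreal (f x))) A \<le> b * measure M A"
proof -
  have "emeasure (density M (\<lambda>x. ennreal (f x))) A = (\<integral>\<^sup>+z. ennreal (f z) * indicator A z \<partial>M)"
    by (simp add: emeasure_density)
  also have "\<dots> \<le> (\<integral>\<^sup>+z. ennreal b * indicator A z \<partial>M)"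
    using assms(5) by (intro nn_integral_mono) (auto simp: indicator_def intro: ennreal_leI)
  also have "\<dots> = ennreal b * emeasure M A"
    by (simp add: nn_integral_cmult_indicator)
  also have "\<dots> = ennreal (b * measure M A)"
    using assms(3,4) by (simp add: emeasure_eq_ennreal_measure less_top ennreal_mult)
  finally show ?thesis
    using assms(4) by (simp add: measure_def enn2real_leI)
qed

text \<open>Both \<open>1 - a\<close> and \<open>exp (- a)\<close> lie between 0 and 1 and differ by
  at most \<open>a\<^sup>2\<close>, so their powers differ by at most
  \<open>(m - 1) * a\<^sup>2\<close>, which vanishes since \<open>m * a\<close> converges and
  \<open>a\<close> tends to zero. The exponent is \<open>m - 1\<close> because an isolated point
  must be missed by the \<open>m - 1\<close> other points.\<close>

lemma tendsto_one_minus_power_exp: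
  fixes a :: "nat \<Rightarrow> real" and m :: "nat \<Rightarrow> nat"
  assumes a: "\<And>k. 0 \<le> a k" "\<And>k. a k \<le> 1" "a \<longlonglongrightarrow> 0"
    and ma: "(\<lambda>k. real (m k) * a k) \<longlonglongrightarrow> c"
  shows "(\<lambda>k. (1 - a k) ^ (m k - 1)) \<longlonglongrightarrow> exp (- c)"
proof -
  \<comment> \<open>Dropping one factor costs at most \<open>a k\<close>; for \<open>m k = 0\<close>
    truncated subtraction costs nothing.\<close>
  have ma': "(\<lambda>k. real (m k - 1) * a k) \<longlonglongrightarrow> c"
  proof (rule Lim_transform[OF ma])
    show "(\<lambda>k. real (m k - 1) * a k - real (m k) * a k) \<longlonglongrightarrow> 0"
    proof (rule tendsto_0_le[OF a(3), where K = 1])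
      show "\<forall>\<^sub>F k in sequentially. norm (real (m k - 1) * a k - real (m k) * a k) \<le> norm (a k) * 1"
      proof (rule always_eventually, rule allI)
        fix k show "norm (real (m k - 1) * a k - real (m k) * a k) \<le> norm (a k) * 1"
          using a(1)[of k] by (cases "m k") (auto simp: algebra_simps)
      qed
    qed
  qed
  have "(\<lambda>k. exp (- (real (m k - 1) * a k))) \<longlonglongrightarrow> exp (- c)"
    by (intro tendsto_intros ma')
  then have e: "(\<lambda>k. exp (- a k) ^ (m k - 1)) \<longlonglongrightarrow> exp (- c)"
    by (simp add: exp_of_nat_mult[symmetric])
  have "(\<lambda>k. (1 - a k) ^ (m k - 1) - exp (- a k) ^ (m k - 1)) \<longlonglongrightarrow> 0"
  proof (rule tendsto_0_le[where K = 1])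
    show "(\<lambda>k. (real (m k - 1) * a k) * a k) \<longlonglongrightarrow> 0"
      using tendsto_mult[OF ma' a(3)] by simp
    show "\<forall>\<^sub>F k in sequentially. norm ((1 - a k) ^ (m k - 1) - exp (- a k) ^ (m k - 1))
        \<le> norm ((real (m k - 1) * a k) * a k) * 1"
    proof (rule always_eventually, rule allI)
      fix k
      have "\<bar>exp (- a k) - (1 - a k)\<bar> \<le> (a k)\<^sup>2"
      proof -
        have "1 - a k \<le> exp (- a k)" using exp_ge_add_one_self[of "- a k"] by simp
        moreover have "exp (- a k) \<le> 1 - a k + (a k)\<^sup>2"
        proof -
          have "exp (- a k) * (1 + a k) \<le> exp (- a k) * exp (a k)"
            by (intro mult_left_mono) auto
          then have "exp (- a k) \<le> 1 / (1 + a k)"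
            using a(1)[of k] by (simp add: exp_minus field_simps)
          also have "\<dots> \<le> 1 - a k + (a k)\<^sup>2"
          proof -
            have "(1 + a k) * (1 - a k + (a k)\<^sup>2) = 1 + a k ^ 3"
              by (simp add: algebra_simps power2_eq_square power3_eq_cube)
            then show ?thesis using a(1)[of k] by (simp add: divide_le_eq mult.commute)
          qed
          finally show ?thesis .
        qed
        ultimately show ?thesis by simp
      qed
      then have "norm ((1 - a k) - exp (- a k)) \<le> (a k)\<^sup>2" by (simp add: abs_minus_commute)
      moreover have "norm ((1 - a k) ^ (m k - 1) - exp (- a k) ^ (m k - 1))
          \<le> (m k - 1) * norm ((1 - a k) - exp (- a k))"
        using a(1,2)[of k] by (intro norm_power_diff) auto
      ultimately have "norm ((1 - a k) ^ (m k - 1) - exp (- a k) ^ (m k - 1))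
          \<le> (m k - 1) * (a k)\<^sup>2"
        by (meson mult_left_mono of_nat_0_le_iff order_trans)
      also have "\<dots> = norm ((real (m k - 1) * a k) * a k) * 1"
        using a(1)[of k] by (simp add: power2_eq_square)
      finally show "norm ((1 - a k) ^ (m k - 1) - exp (- a k) ^ (m k - 1))
          \<le> norm ((real (m k - 1) * a k) * a k) * 1" .
    qed
  qed
  from tendsto_add[OF this e] show ?thesis by simp
qed

section \<open>Isolated points and their counts\<close>

text \<open>Indices are counted instead of vertices, so that the cardinality is a sum of indicators
  even for coinciding points, and counts for different \<open>n\<close> and \<open>r\<close> are
  easy to compare.\<close>

definition isolated_indices ::
  "('a::real_vector \<Rightarrow> real) \<Rightarrow> nat \<Rightarrow> (nat \<Rightarrow> 'a) \<Rightarrow> (nat \<Rightarrow> real) \<Rightarrow> nat set" where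
  "isolated_indices N n x r = {i \<in> {1..n}. \<forall>j \<in> {1..n} - {i}. r i \<le> N (x j - x i)}"

lemma isolated_indices_subset: "isolated_indices N n x r \<subseteq> {1..n}"
  by (auto simp: isolated_indices_def)

lemma finite_isolated_indices [simp]: "finite (isolated_indices N n x r)"
  using finite_subset[OF isolated_indices_subset] by blast

lemma card_isolated_indices_mono:
  assumes "\<And>i. i \<in> {1..n} \<Longrightarrow> s i \<le> r i"
  shows "card (isolated_indices N n x r) \<le> card (isolated_indices N n x s)"
  using assms by (intro card_mono) (auto simp: isolated_indices_def intro: order_trans)

text \<open>An index isolated for \<open>r\<close> stays isolated for \<open>s\<close> unless
  \<open>r i < s i\<close>. This absorbs the few exceptional random radii in a comparison with a
  constant radius.\<close>

lemma card_isolated_indices_le_add: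
  "card (isolated_indices N n x r) \<le> card (isolated_indices N n x s) + card {i \<in> {1..n}. r i < s i}"
proof -
  have "isolated_indices N n x r \<subseteq> isolated_indices N n x s \<union> {i \<in> {1..n}. r i < s i}"
    by (auto simp: isolated_indices_def not_less intro: order_trans)
  then have "card (isolated_indices N n x r) \<le> card (isolated_indices N n x s \<union> {i \<in> {1..n}. r i < s i})"
    by (intro card_mono) auto
  also have "\<dots> \<le> card (isolated_indices N n x s) + card {i \<in> {1..n}. r i < s i}"
    by (rule card_Un_le)
  finally show ?thesis .
qed

text \<open>Additional points can only end the isolation of old ones, and at most
  \<open>n - m\<close> new indices join.\<close>

lemma card_isolated_indices_extend:
  assumes "m \<le> n"
  shows "card (isolated_indices N n x r) \<le> card (isolated_indices N m x r) + (n - m)"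
proof -
  have "isolated_indices N n x r \<subseteq> isolated_indices N m x r \<union> {m<..n}"
    using assms by (auto simp: isolated_indices_def)
  then have "card (isolated_indices N n x r) \<le> card (isolated_indices N m x r \<union> {m<..n})"
    by (intro card_mono) auto
  also have "\<dots> \<le> card (isolated_indices N m x r) + card {m<..n}"
    by (rule card_Un_le)
  finally show ?thesis by simp
qed

lemma num_isolated_geometric_digraph:
  assumes N: "is_norm N" and r: "\<And>i. i \<in> {1..n} \<Longrightarrow> 0 < r i"
  shows "num_isolated single_vertex (geometric_digraph N n x r) = card (isolated_indices N n x r)"
proof -
  let ?G = "geometric_digraph N n x r"
  have N0: "N 0 = 0" using is_normD(2)[OF N] by blast
  \<comment> \<open>With a positive radius, a second point at the same location would lie in the
    ball. So an isolated index shares its location with no other index, and passing from indices to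
    vertices loses nothing.\<close>
  have uniq: "i = j" if "i \<in> isolated_indices N n x r" "j \<in> {1..n}" "x i = x j" for i j
  proof (rule ccontr)
    assume "i \<noteq> j"
    then have "r i \<le> N (x j - x i)" "i \<in> {1..n}"
      using that(1,2) unfolding isolated_indices_def by blast+
    then show False using that(3) r[of i] N0 by simp
  qed
  have "{v \<in> verts ?G. \<forall>e\<in>arcs ?G. tail ?G e \<noteq> v} = x ` isolated_indices N n x r"
    (is "?L = ?R")
  proof
    show "?L \<subseteq> ?R"
    proof
      fix v assume v: "v \<in> ?L"
      then obtain i where i: "i \<in> {1..n}" "v = x i" by (auto simp: geometric_digraph_def)
      have "r i \<le> N (x j - x i)" if j: "j \<in> {1..n} - {i}" for j
      proof (rule ccontr)
        assume "\<not> r i \<le> N (x j - x i)"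
        then have "(x i, x j) \<in> arcs ?G"
          using i j unfolding geometric_digraph_def norm_ball_def by fastforce
        then show False using v i by (auto simp: geometric_digraph_def)
      qed
      then show "v \<in> ?R" using i by (auto simp: isolated_indices_def)
    qed
    show "?R \<subseteq> ?L"
    proof
      fix v assume "v \<in> ?R"
      then obtain i where i: "i \<in> isolated_indices N n x r" "v = x i" by blast
      have "tail ?G e \<noteq> v" if "e \<in> arcs ?G" for e
      proof
        assume "tail ?G e = v"
        with that obtain i' j where ij: "i' \<in> {1..n}" "j \<in> {1..n}" "i' \<noteq> j" "x i' = x i"
            "N (x j - x i') < r i'"
          using i by (auto simp: geometric_digraph_def norm_ball_def)
        then have "i = i'" using uniq[OF i(1), of i'] by simp
        then have "r i' \<le> N (x j - x i')"
          using i(1) ij unfolding isolated_indices_def by blast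
        with ij(5) show False by simp
      qed
      moreover have "v \<in> verts ?G"
        using i by (auto simp: isolated_indices_def geometric_digraph_def)
      ultimately show "v \<in> ?L" by blast
    qed
  qed
  moreover have "inj_on x (isolated_indices N n x r)"
    using uniq isolated_indices_subset[of N n x r] by (auto simp: inj_on_def)
  ultimately show ?thesis
    by (simp add: num_isolated_single_vertex[OF wf_geometric_digraph] card_image)
qed

text \<open>For \<open>n\<close> between consecutive squares, moving to a square changes the count
  by at most the gap through the points and monotonically through the radius. Pairing the points of
  one square with the radius of the other lets the two comparisons be chained, whence the mixed
  squares in \<open>up\<close> and \<open>lo\<close>.\<close>

lemma isolated_indices_interpolation:
  fixes \<rho> :: "nat \<Rightarrow> real"
  assumes \<rho>: "decseq \<rho>"
    and up: "(\<lambda>k. card (isolated_indices N ((Suc k)\<^sup>2) x (\<lambda>_. \<rho> ((k + 2)\<^sup>2))) / (Suc k)\<^sup>2) \<longlonglongrightarrow> l"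
    and lo: "(\<lambda>k. card (isolated_indices N ((k + 2)\<^sup>2) x (\<lambda>_. \<rho> ((Suc k)\<^sup>2))) / (k + 2)\<^sup>2) \<longlonglongrightarrow> l"
  shows "(\<lambda>n. card (isolated_indices N n x (\<lambda>_. \<rho> n)) / n) \<longlonglongrightarrow> l"
proof -
  define I where "I n m = real (card (isolated_indices N n x (\<lambda>_. \<rho> m)))" for n m
  \<comment> \<open>The numerator \<open>2 * k + 3\<close> is the gap between
    \<open>(Suc k)\<^sup>2\<close> and \<open>(k + 2)\<^sup>2\<close>; divided by a square it
    vanishes.\<close>
  define U where "U k = I ((Suc k)\<^sup>2) ((k + 2)\<^sup>2) / (Suc k)\<^sup>2 + (2 * k + 3) / (Suc k)\<^sup>2" for k
  define L where "L k = I ((k + 2)\<^sup>2) ((Suc k)\<^sup>2) / (k + 2)\<^sup>2 - (2 * k + 3) / (Suc k)\<^sup>2" for k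
  \<comment> \<open>After this shift \<open>Suc (K n)\<close> is \<open>floor_sqrt n\<close> for
    positive \<open>n\<close>, so only nonzero squares occur as denominators.\<close>
  define K where "K n = floor_sqrt n - 1" for n
  have gap: "(\<lambda>k. (2 * k + 3) / (Suc k)\<^sup>2) \<longlonglongrightarrow> (0::real)"
    by real_asymp
  have U: "U \<longlonglongrightarrow> l" unfolding U_def I_def using tendsto_add[OF up gap] by simp
  have L: "L \<longlonglongrightarrow> l" unfolding L_def I_def using tendsto_diff[OF lo gap] by (simp add: add.commute)
  have K: "filterlim K at_top sequentially"
    unfolding filterlim_at_top
  proof
    fix Z
    show "\<forall>\<^sub>F n in sequentially. Z \<le> K n"
    proof (rule eventually_sequentiallyI)
      fix n assume "(Z + 1)\<^sup>2 \<le> n"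
      then have "Z + 1 \<le> floor_sqrt n" by (rule le_floor_sqrtI)
      then show "Z \<le> K n" by (simp add: K_def)
    qed
  qed
  have bounds: "L (K n) \<le> I n n / n \<and> I n n / n \<le> U (K n)" if n: "1 \<le> n" for n
  proof -
    let ?m = "(Suc (K n))\<^sup>2" and ?m' = "(K n + 2)\<^sup>2"
    have "0 < floor_sqrt n" using n by simp
    then have S: "Suc (K n) = floor_sqrt n" "K n + 2 = Suc (floor_sqrt n)" by (auto simp: K_def)
    have m: "?m \<le> n" "n \<le> ?m'" "0 < ?m"
      unfolding S using Suc_floor_sqrt_power2_gt[of n] n by auto
    then have mr: "real ?m \<le> real n" "real n \<le> real ?m'" "0 < real ?m" "0 < real n" "0 < real ?m'"
      unfolding of_nat_le_iff of_nat_0_less_iff using n by auto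
    have m': "?m' = ?m + (2 * K n + 3)" by (simp add: power2_eq_square)
    have nm: "n - ?m \<le> 2 * K n + 3" "?m' - n \<le> 2 * K n + 3" using m m' by linarith+
    have "I n n \<le> I n ?m'"
      unfolding I_def of_nat_le_iff by (intro card_isolated_indices_mono decseqD[OF \<rho>] m)
    also have "\<dots> \<le> I ?m ?m' + real (n - ?m)"
      unfolding I_def of_nat_add[symmetric] of_nat_le_iff by (intro card_isolated_indices_extend m)
    also have "\<dots> \<le> I ?m ?m' + (2 * K n + 3)" using nm(1) by linarith
    finally have "I n n / n \<le> (I ?m ?m' + (2 * K n + 3)) / n"
      by (intro divide_right_mono) auto
    also have "\<dots> \<le> (I ?m ?m' + (2 * K n + 3)) / ?m"
      using mr by (intro divide_left_mono mult_pos_pos) (simp_all add: I_def del: of_nat_power)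
    also have "\<dots> = U (K n)" by (simp add: U_def add_divide_distrib)
    finally have 1: "I n n / n \<le> U (K n)" .
    have "I ?m' ?m \<le> I ?m' n"
      unfolding I_def of_nat_le_iff by (intro card_isolated_indices_mono decseqD[OF \<rho>] m)
    also have "\<dots> \<le> I n n + real (?m' - n)"
      unfolding I_def of_nat_add[symmetric] of_nat_le_iff by (intro card_isolated_indices_extend m)
    also have "\<dots> \<le> I n n + (2 * K n + 3)" using nm(2) by linarith
    finally have "I ?m' ?m / n \<le> (I n n + (2 * K n + 3)) / n"
      by (intro divide_right_mono) auto
    also have "\<dots> \<le> I n n / n + (2 * K n + 3) / ?m"
      unfolding add_divide_distrib using mr by (intro add_left_mono divide_left_mono mult_pos_pos) auto
    finally have "I ?m' ?m / n - (2 * K n + 3) / ?m \<le> I n n / n" by simp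
    moreover have "I ?m' ?m / ?m' \<le> I ?m' ?m / n"
      using mr by (intro divide_left_mono mult_pos_pos) (auto simp: I_def)
    ultimately have "L (K n) \<le> I n n / n" by (simp add: L_def add.commute)
    with 1 show ?thesis by simp
  qed
  have "(\<lambda>n. I n n / n) \<longlonglongrightarrow> l"
  proof (rule tendsto_sandwich)
    show "\<forall>\<^sub>F n in sequentially. L (K n) \<le> I n n / n" "\<forall>\<^sub>F n in sequentially. I n n / n \<le> U (K n)"
      using bounds by (auto intro!: eventually_sequentiallyI[of 1])
  qed (use filterlim_compose[OF L K] filterlim_compose[OF U K] in auto)
  then show ?thesis by (simp add: I_def)
qed

section \<open>Moments of the number of isolated points of an i.i.d. sample\<close>

locale normed_prob_space = prob_space D for D :: "'a::euclidean_space measure" +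
  fixes N :: "'a \<Rightarrow> real"
  assumes N: "is_norm N" and sets_D [measurable_cong]: "sets D = sets borel"
begin

text \<open>Its \<open>m\<close>-th power is the probability that a point located at
  \<open>y\<close> is isolated from \<open>m\<close> independent further points.\<close>

definition miss :: "real \<Rightarrow> 'a \<Rightarrow> real" where
  "miss r y = 1 - prob (norm_ball N y r)"

lemma space_D [simp]: "space D = UNIV"
  using sets_eq_imp_space_eq[OF sets_D] by simp

lemma prob_UNIV [simp]: "prob UNIV = 1"
  using prob_space by simp

lemma N_measurable [measurable]: "N \<in> borel_measurable borel"
  by (rule is_norm_borel_measurable[OF N])

lemma ball_sets [measurable]: "norm_ball N x r \<in> sets D"
  using norm_ball_borel[OF N] by (simp add: sets_D)

lemma miss_bounds: "0 \<le> miss r y" "miss r y \<le> 1"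
  by (auto simp: miss_def)

lemma prob_far: "prob {z. r \<le> N (z - y)} = miss r y"
proof -
  have "{z. r \<le> N (z - y)} = space D - norm_ball N y r" by (auto simp: norm_ball_def)
  then show ?thesis using prob_compl[OF ball_sets[of y r]] by (simp add: miss_def)
qed

text \<open>The ball probability is rewritten as a parameter integral whose integrand is jointly
  measurable in the centre and the point.\<close>

lemma miss_measurable [measurable]: "miss r \<in> borel_measurable borel"
proof -
  have "prob (norm_ball N y r) = (\<integral>z. indicat_real {..<r} (N (z - y)) \<partial>D)" for y
  proof -
    have "(\<integral>z. indicat_real {..<r} (N (z - y)) \<partial>D) = (\<integral>z. indicator (norm_ball N y r) z \<partial>D)"
      by (rule Bochner_Integration.integral_cong) (auto simp: norm_ball_def indicator_def)
    also have "\<dots> = prob (norm_ball N y r)"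
      by simp
    finally show ?thesis by simp
  qed
  moreover have "(\<lambda>y. \<integral>z. indicat_real {..<r} (N (z - y)) \<partial>D) \<in> borel_measurable borel"
    by measurable
  ultimately show ?thesis by (simp add: miss_def[abs_def])
qed

lemma integrable_miss_power [simp]: "integrable D (\<lambda>y. miss r y ^ m)"
  by (rule integrable_const_bound[where B = 1]) (auto simp: miss_bounds power_le_one)

lemma nn_integral_miss_power:
  "(\<integral>\<^sup>+y. ennreal (miss r y ^ m) \<partial>D) = ennreal (\<integral>y. miss r y ^ m \<partial>D)"
  by (rule nn_integral_eq_integral) (auto simp: miss_bounds)

lemma integral_miss_power_bounds: "0 \<le> (\<integral>y. miss r y ^ m \<partial>D)" "(\<integral>y. miss r y ^ m \<partial>D) \<le> 1"
proof -
  show "0 \<le> (\<integral>y. miss r y ^ m \<partial>D)" by (simp add: miss_bounds)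
  have "(\<integral>y. miss r y ^ m \<partial>D) \<le> (\<integral>y. 1 \<partial>D)"
    by (intro integral_mono) (auto simp: miss_bounds power_le_one)
  then show "(\<integral>y. miss r y ^ m \<partial>D) \<le> 1" by simp
qed

section \<open>Isolation events under the product measure\<close>

lemma emeasure_PiM_power:
  assumes "finite J" "A \<in> sets D"
  shows "emeasure (PiM J (\<lambda>_. D)) {x \<in> space (PiM J (\<lambda>_. D)). \<forall>j\<in>J. x j \<in> A}
    = ennreal (prob A ^ card J)"
proof -
  interpret P: product_prob_space "\<lambda>_. D" J
    by unfold_locales
  have "{x \<in> space (PiM J (\<lambda>_. D)). \<forall>j\<in>J. x j \<in> A} = Pi\<^sub>E J (\<lambda>_. A)"
    by (auto simp: space_PiM PiE_iff extensional_def)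
  then show ?thesis
    using assms by (simp add: P.emeasure_PiM emeasure_eq_measure prod_ennreal ennreal_power)
qed

text \<open>Fubini with coordinate \<open>i\<close> outermost: given \<open>x i = y\<close>, the
  other coordinates independently avoid the ball around \<open>y\<close>.\<close>

lemma emeasure_isolated:
  assumes J: "finite J" "i \<notin> J"
  defines "P \<equiv> PiM (insert i J) (\<lambda>_. D)"
  shows "emeasure P {x \<in> space P. \<forall>j\<in>J. r \<le> N (x j - x i)}
    = ennreal (\<integral>y. miss r y ^ card J \<partial>D)"
proof -
  interpret P: product_prob_space "\<lambda>_. D" J
    by unfold_locales
  let ?S = "{x \<in> space P. \<forall>j\<in>J. r \<le> N (x j - x i)}"
  have [measurable]: "?S \<in> sets P"
    unfolding P_def using J(1) by measurable
  have "emeasure P ?S = (\<integral>\<^sup>+x. indicator ?S x \<partial>P)" by simp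
  also have "\<dots> = (\<integral>\<^sup>+y. (\<integral>\<^sup>+x. indicator ?S (x(i := y)) \<partial>PiM J (\<lambda>_. D)) \<partial>D)"
    unfolding P_def
    by (rule P.product_nn_integral_insert_rev[OF J]) (simp add: P_def[symmetric])
  also have "\<dots> = (\<integral>\<^sup>+y. ennreal (miss r y ^ card J) \<partial>D)"
  proof (rule nn_integral_cong)
    fix y
    let ?A = "{z. r \<le> N (z - y)}"
    have "(\<integral>\<^sup>+x. indicator ?S (x(i := y)) \<partial>PiM J (\<lambda>_. D))
      = (\<integral>\<^sup>+x. indicator {x \<in> space (PiM J (\<lambda>_. D)). \<forall>j\<in>J. x j \<in> ?A} x \<partial>PiM J (\<lambda>_. D))"
    proof (rule nn_integral_cong)
      fix x assume x: "x \<in> space (PiM J (\<lambda>_. D))"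
      then have "x(i := y) \<in> space P" by (auto simp: P_def space_PiM PiE_iff extensional_def)
      moreover have "(\<forall>j\<in>J. r \<le> N ((x(i := y)) j - (x(i := y)) i)) \<longleftrightarrow> (\<forall>j\<in>J. x j \<in> ?A)"
        using J(2) by auto
      ultimately show "indicator ?S (x(i := y))
          = indicator {x \<in> space (PiM J (\<lambda>_. D)). \<forall>j\<in>J. x j \<in> ?A} x"
        using x by (simp add: indicator_def)
    qed
    also have "\<dots> = emeasure (PiM J (\<lambda>_. D)) {x \<in> space (PiM J (\<lambda>_. D)). \<forall>j\<in>J. x j \<in> ?A}"
      using J(1) by (intro nn_integral_indicator) measurable
    also have "\<dots> = ennreal (prob ?A ^ card J)"
      by (rule emeasure_PiM_power[OF J(1)]) measurable
    finally show "(\<integral>\<^sup>+x. indicator ?S (x(i := y)) \<partial>PiM J (\<lambda>_. D)) = ennreal (miss r y ^ card J)"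
      by (simp only: prob_far)
  qed
  finally show ?thesis by (simp add: nn_integral_miss_power)
qed

text \<open>The two balls are disjoint by the triangle inequality, and
  \<open>1 - (p + q) \<le> (1 - p) * (1 - q)\<close> for probabilities. This is the negative
  correlation behind the variance bound.\<close>

lemma prob_far_pair_le:
  assumes "2 * r \<le> N (z - y)"
  shows "prob {w. r \<le> N (w - y) \<and> r \<le> N (w - z)} \<le> miss r y * miss r z"
proof -
  have disj: "norm_ball N y r \<inter> norm_ball N z r = {}"
  proof (rule ccontr)
    assume "norm_ball N y r \<inter> norm_ball N z r \<noteq> {}"
    then obtain w where "N (w - y) < r" "N (w - z) < r" by (auto simp: norm_ball_def)
    then show False
      using assms is_normD(4)[OF N, of "z - w" "w - y"] is_norm_minus_commute[OF N, of w z] by simp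
  qed
  have "{w. r \<le> N (w - y) \<and> r \<le> N (w - z)} = space D - (norm_ball N y r \<union> norm_ball N z r)"
    by (auto simp: norm_ball_def)
  then have "prob {w. r \<le> N (w - y) \<and> r \<le> N (w - z)}
      = 1 - (prob (norm_ball N y r) + prob (norm_ball N z r))"
    using prob_compl[of "norm_ball N y r \<union> norm_ball N z r"] finite_measure_Union[OF _ _ disj]
    by simp
  also have "\<dots> \<le> miss r y * miss r z"
    by (simp add: miss_def algebra_simps)
  finally show ?thesis .
qed

text \<open>Fixing the locations of \<open>i\<close> and \<open>k\<close> leaves independent
  coordinates. Near pairs are bounded by one and contribute at most \<open>\<beta>\<close>; far
  pairs have disjoint balls and give a product, whose integral factorises into the square.\<close>

lemma emeasure_isolated_pair_le:
  assumes J: "finite J" "i \<notin> J" "k \<notin> J" "i \<noteq> k"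
    and \<beta>: "\<And>y. prob (norm_ball N y (2 * r)) \<le> \<beta>"
  defines "P \<equiv> PiM (insert i (insert k J)) (\<lambda>_. D)"
  shows "emeasure P {x \<in> space P. \<forall>j\<in>J. r \<le> N (x j - x i) \<and> r \<le> N (x j - x k)}
    \<le> ennreal (\<beta> + (\<integral>y. miss r y ^ card J \<partial>D)\<^sup>2)"
proof -
  interpret P: product_prob_space "\<lambda>_. D" J
    by unfold_locales
  define e where "e = (\<integral>y. miss r y ^ card J \<partial>D)"
  let ?S = "{x \<in> space P. \<forall>j\<in>J. r \<le> N (x j - x i) \<and> r \<le> N (x j - x k)}"
  let ?Q = "PiM (insert k J) (\<lambda>_. D)"
  have [measurable]: "?S \<in> sets P"
    unfolding P_def using J(1) by measurable
  have S_meas: "(\<lambda>x. indicator ?S (x(i := y)) :: ennreal) \<in> borel_measurable ?Q" for y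
  proof -
    have "(\<lambda>x. x(i := y)) \<in> measurable ?Q P"
      unfolding P_def by (rule measurable_fun_upd) auto
    then show ?thesis by measurable
  qed
  have inner: "(\<integral>\<^sup>+x. indicator ?S (x(k := z, i := y)) \<partial>PiM J (\<lambda>_. D))
      \<le> indicator (norm_ball N y (2 * r)) z + ennreal (miss r y ^ card J) * ennreal (miss r z ^ card J)"
    (is "?lhs \<le> _") for y z
  proof -
    let ?A = "{w. r \<le> N (w - y) \<and> r \<le> N (w - z)}"
    have "?lhs = (\<integral>\<^sup>+x. indicator {x \<in> space (PiM J (\<lambda>_. D)). \<forall>j\<in>J. x j \<in> ?A} x \<partial>PiM J (\<lambda>_. D))"
    proof (rule nn_integral_cong)
      fix x assume x: "x \<in> space (PiM J (\<lambda>_. D))"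
      then have "x(k := z, i := y) \<in> space P" by (auto simp: P_def space_PiM PiE_iff extensional_def)
      moreover have "(\<forall>j\<in>J. r \<le> N ((x(k := z, i := y)) j - (x(k := z, i := y)) i)
          \<and> r \<le> N ((x(k := z, i := y)) j - (x(k := z, i := y)) k)) \<longleftrightarrow> (\<forall>j\<in>J. x j \<in> ?A)"
        using J by auto
      ultimately show "indicator ?S (x(k := z, i := y))
          = indicator {x \<in> space (PiM J (\<lambda>_. D)). \<forall>j\<in>J. x j \<in> ?A} x"
        using x by (simp add: indicator_def)
    qed
    also have "\<dots> = emeasure (PiM J (\<lambda>_. D)) {x \<in> space (PiM J (\<lambda>_. D)). \<forall>j\<in>J. x j \<in> ?A}"
      using J(1) by (intro nn_integral_indicator) measurable
    also have "\<dots> = ennreal (prob ?A ^ card J)"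
      by (rule emeasure_PiM_power[OF J(1)]) measurable
    also have "\<dots> \<le> indicator (norm_ball N y (2 * r)) z
        + ennreal (miss r y ^ card J) * ennreal (miss r z ^ card J)"
    proof (cases "z \<in> norm_ball N y (2 * r)")
      case True
      have "ennreal (prob ?A ^ card J) \<le> 1" by (simp add: power_le_one)
      also have "(1::ennreal) \<le> 1 + ennreal (miss r y ^ card J) * ennreal (miss r z ^ card J)" by simp
      finally show ?thesis using True by simp
    next
      case False
      then have "prob ?A ^ card J \<le> (miss r y * miss r z) ^ card J"
        by (intro power_mono prob_far_pair_le) (auto simp: norm_ball_def)
      then show ?thesis
        using False
        by (simp add: ennreal_mult[symmetric] miss_bounds power_mult_distrib ennreal_leI)
    qed
    finally show ?thesis .
  qed
  have "emeasure P ?S = (\<integral>\<^sup>+x. indicator ?S x \<partial>P)" by simp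
  also have "\<dots> = (\<integral>\<^sup>+y. (\<integral>\<^sup>+x. indicator ?S (x(i := y)) \<partial>?Q) \<partial>D)"
    unfolding P_def using J
    by (intro P.product_nn_integral_insert_rev) (simp_all add: P_def[symmetric])
  also have "\<dots> = (\<integral>\<^sup>+y. (\<integral>\<^sup>+z. (\<integral>\<^sup>+x. indicator ?S (x(k := z, i := y)) \<partial>PiM J (\<lambda>_. D)) \<partial>D) \<partial>D)"
    by (intro nn_integral_cong P.product_nn_integral_insert_rev[OF J(1,3) S_meas])
  also have "\<dots> \<le> (\<integral>\<^sup>+y. (\<integral>\<^sup>+z. indicator (norm_ball N y (2 * r)) z
      + ennreal (miss r y ^ card J) * ennreal (miss r z ^ card J) \<partial>D) \<partial>D)"
    by (intro nn_integral_mono inner)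
  also have "\<dots> = (\<integral>\<^sup>+y. emeasure D (norm_ball N y (2 * r)) + ennreal (miss r y ^ card J) * ennreal e \<partial>D)"
    by (intro nn_integral_cong)
      (simp add: nn_integral_add nn_integral_cmult nn_integral_miss_power e_def)
  also have "\<dots> \<le> (\<integral>\<^sup>+y. ennreal \<beta> + ennreal (miss r y ^ card J) * ennreal e \<partial>D)"
    by (intro nn_integral_mono add_right_mono) (simp add: emeasure_eq_measure \<beta> ennreal_leI)
  also have "\<dots> = ennreal \<beta> + ennreal e * ennreal e"
    by (simp add: nn_integral_add nn_integral_multc nn_integral_miss_power e_def emeasure_eq_measure)
  also have "\<dots> = ennreal (\<beta> + e\<^sup>2)"
  proof -
    have "0 \<le> \<beta>" using \<beta>[of 0] measure_nonneg order_trans by blast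
    moreover have "0 \<le> e" by (simp add: e_def integral_miss_power_bounds)
    ultimately show ?thesis by (simp add: ennreal_mult[symmetric] power2_eq_square)
  qed
  finally show ?thesis by (simp only: e_def)
qed

text \<open>The pair estimate involves \<open>n - 2\<close> remaining points, the mean
  \<open>n - 1\<close>. One more point multiplies the integrand by \<open>miss r y\<close>, which
  removes at most the ball probability.\<close>

lemma integral_miss_power_diff_le:
  assumes \<beta>: "\<And>y. prob (norm_ball N y r) \<le> \<beta>"
  shows "(\<integral>y. miss r y ^ (n - 2) \<partial>D) - (\<integral>y. miss r y ^ (n - 1) \<partial>D) \<le> \<beta>"
proof -
  have \<beta>0: "0 \<le> \<beta>" using \<beta>[of 0] measure_nonneg order_trans by blast
  have "(\<integral>y. miss r y ^ (n - 2) \<partial>D) - (\<integral>y. miss r y ^ (n - 1) \<partial>D)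
      = (\<integral>y. miss r y ^ (n - 2) - miss r y ^ (n - 1) \<partial>D)"
    by simp
  also have "\<dots> \<le> (\<integral>y. \<beta> \<partial>D)"
  proof (intro integral_mono)
    fix y
    show "miss r y ^ (n - 2) - miss r y ^ (n - 1) \<le> \<beta>"
    \<comment> \<open>For \<open>n \<le> 1\<close> both truncated exponents are zero, so the
      difference vanishes.\<close>
    proof (cases "n \<le> 1")
      case False
      then have "n - 1 = Suc (n - 2)" by simp
      then have "miss r y ^ (n - 2) - miss r y ^ (n - 1) = miss r y ^ (n - 2) * (1 - miss r y)"
        by (simp add: algebra_simps)
      also have "\<dots> \<le> 1 * (1 - miss r y)"
        by (intro mult_right_mono) (auto simp: miss_bounds power_le_one)
      also have "\<dots> \<le> \<beta>" using \<beta>[of y] by (simp add: miss_def)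
      finally show ?thesis .
    qed (use \<beta>0 in auto)
  qed auto
  finally show ?thesis by simp
qed

lemma card_isolated_indices_eq:
  "real (card (isolated_indices N n x r))
    = (\<Sum>i\<in>{1..n}. indicator {x. \<forall>j\<in>{1..n} - {i}. r i \<le> N (x j - x i)} x)"
proof -
  have "(\<Sum>i\<in>{1..n}. indicator {x. \<forall>j\<in>{1..n} - {i}. r i \<le> N (x j - x i)} x)
    = (\<Sum>i\<in>{1..n}. if i \<in> isolated_indices N n x r then 1 else (0::real))"
    by (intro sum.cong) (auto simp: isolated_indices_def indicator_def)
  also have "\<dots> = real (card ({1..n} \<inter> isolated_indices N n x r))"
    by (simp add: sum.If_cases Int_def)
  also have "{1..n} \<inter> isolated_indices N n x r = isolated_indices N n x r"
    by (auto simp: isolated_indices_def)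
  finally show ?thesis by simp
qed

lemma card_isolated_measurable [measurable]:
  "(\<lambda>x. real (card (isolated_indices N n x (\<lambda>_. r)))) \<in> borel_measurable (PiM {1..n} (\<lambda>_. D))"
proof -
  have "(\<lambda>x. indicator {x. \<forall>j\<in>{1..n} - {i}. r \<le> N (x j - x i)} x :: real)
      \<in> borel_measurable (PiM {1..n} (\<lambda>_. D))" if "i \<in> {1..n}" for i
    using that by measurable
  then show ?thesis unfolding card_isolated_indices_eq by measurable
qed

text \<open>The subtracted integral is the exact mean, so this bounds a variance:
  \<open>1 / n\<close> comes from the diagonal, one \<open>\<beta>\<close> from near pairs, and two
  more from the mismatch of the exponents \<open>n - 2\<close> and \<open>n - 1\<close>.\<close>

lemma second_moment_isolated:
  assumes n: "0 < n" and r: "0 \<le> r"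
    and \<beta>: "\<And>y. prob (norm_ball N y (2 * r)) \<le> \<beta>"
  shows "(\<integral>x. (card (isolated_indices N n x (\<lambda>_. r)) / n - (\<integral>y. miss r y ^ (n - 1) \<partial>D))\<^sup>2
            \<partial>PiM {1..n} (\<lambda>_. D)) \<le> 1 / n + 3 * \<beta>"
proof -
  define P where "P = PiM {1..n} (\<lambda>_::nat. D)"
  interpret P: product_prob_space "\<lambda>_. D" "{1..n}" by unfold_locales
  interpret P: prob_space P unfolding P_def by (rule P.P.prob_space_axioms)
  define e where "e = (\<integral>y. miss r y ^ (n - 1) \<partial>D)"
  define e' where "e' = (\<integral>y. miss r y ^ (n - 2) \<partial>D)"
  define S where "S i = {x \<in> space P. \<forall>j\<in>{1..n} - {i}. r \<le> N (x j - x i)}" for i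
  define Y where "Y x = real (card (isolated_indices N n x (\<lambda>_. r)))" for x
  have e01: "0 \<le> e" "e \<le> 1" "0 \<le> e'" "e' \<le> 1"
    by (auto simp: e_def e'_def integral_miss_power_bounds)
  have \<beta>0: "0 \<le> \<beta>" using \<beta>[of 0] measure_nonneg order_trans by blast
  have S_sets: "S i \<in> sets P" if "i \<in> {1..n}" for i
    unfolding S_def P_def using that by measurable
  have Y_eq: "Y x = (\<Sum>i\<in>{1..n}. indicator (S i) x)" if "x \<in> space P" for x
    unfolding Y_def card_isolated_indices_eq using that
    by (intro sum.cong) (auto simp: S_def indicator_def)
  have pS: "P.prob (S i) = e" if "i \<in> {1..n}" for i
  proof -
    have eq: "insert i ({1..n} - {i}) = {1..n}" using that by auto
    have "emeasure P (S i) = ennreal e"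
      using emeasure_isolated[of "{1..n} - {i}" i r] that
      unfolding eq P_def[symmetric] S_def[symmetric] by (simp add: e_def)
    then show ?thesis using e01 by (simp add: P.emeasure_eq_measure)
  qed
  have pSS: "P.prob (S i \<inter> S k) \<le> \<beta> + e'\<^sup>2" if "i \<in> {1..n}" "k \<in> {1..n}" "i \<noteq> k" for i k
  proof -
    let ?J = "{1..n} - {i, k}"
    let ?T = "{x \<in> space P. \<forall>j\<in>?J. r \<le> N (x j - x i) \<and> r \<le> N (x j - x k)}"
    have eq: "insert i (insert k ?J) = {1..n}" using that by auto
    have "card ?J = n - 2" using that by (subst card_Diff_subset) auto
    then have "emeasure P ?T \<le> ennreal (\<beta> + e'\<^sup>2)"
      using emeasure_isolated_pair_le[of ?J i k r \<beta>] \<beta> that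
      unfolding eq P_def[symmetric] by (simp add: e'_def)
    then have "P.prob ?T \<le> \<beta> + e'\<^sup>2"
      using \<beta>0 by (simp add: P.emeasure_eq_measure del: ennreal_plus)
    moreover have "P.prob (S i \<inter> S k) \<le> P.prob ?T"
    proof (rule P.finite_measure_mono)
      show "S i \<inter> S k \<subseteq> ?T" by (auto simp: S_def)
      show "?T \<in> P.events" unfolding P_def using that by measurable
    qed
    ultimately show ?thesis by simp
  qed
  have intS: "integrable P (indicator (S i) :: _ \<Rightarrow> real)" if "i \<in> {1..n}" for i
    using S_sets[OF that] P.emeasure_finite by (simp add: less_top[symmetric])
  have EY: "(\<integral>x. Y x \<partial>P) = n * e"
  proof -
    have "(\<integral>x. Y x \<partial>P) = (\<integral>x. (\<Sum>i\<in>{1..n}. indicator (S i) x) \<partial>P)"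
      by (intro Bochner_Integration.integral_cong Y_eq refl)
    also have "\<dots> = (\<Sum>i\<in>{1..n}. P.prob (S i))"
      using intS S_sets by (subst Bochner_Integration.integral_sum) (auto intro!: sum.cong)
    finally show ?thesis by (simp add: pS)
  qed
  have EY2: "(\<integral>x. (Y x)\<^sup>2 \<partial>P) \<le> n + n\<^sup>2 * (\<beta> + e'\<^sup>2)"
  proof -
    have "(\<integral>x. (Y x)\<^sup>2 \<partial>P) = (\<integral>x. (\<Sum>i\<in>{1..n}. \<Sum>k\<in>{1..n}. indicator (S i \<inter> S k) x) \<partial>P)"
      by (intro Bochner_Integration.integral_cong refl)
        (simp add: Y_eq power2_eq_square sum_product indicator_inter_arith)
    also have "\<dots> = (\<Sum>i\<in>{1..n}. \<Sum>k\<in>{1..n}. P.prob (S i \<inter> S k))"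
    proof -
      have "integrable P (indicator (S i \<inter> S k) :: _ \<Rightarrow> real)" "S i \<inter> S k \<inter> space P = S i \<inter> S k"
        if "i \<in> {1..n}" "k \<in> {1..n}" for i k
        using S_sets[OF that(1)] S_sets[OF that(2)] P.emeasure_finite
        by (auto simp: less_top[symmetric] S_def)
      then show ?thesis
        by (subst Bochner_Integration.integral_sum)
          (auto intro!: sum.cong integrable_sum simp del: integral_indicator
            simp: Bochner_Integration.integral_sum Bochner_Integration.integral_indicator)
    qed
    \<comment> \<open>The diagonal gets the trivial bound 1; adding the nonnegative pair bound there
      too keeps the sum uniform.\<close>
    also have "\<dots> \<le> (\<Sum>i\<in>{1..n}. \<Sum>k\<in>{1..n}. (if i = k then 1 else 0) + (\<beta> + e'\<^sup>2))"
    proof (intro sum_mono)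
      fix i k assume ik: "i \<in> {1..n}" "k \<in> {1..n}"
      show "P.prob (S i \<inter> S k) \<le> (if i = k then 1 else 0) + (\<beta> + e'\<^sup>2)"
        using pSS[OF ik] \<beta>0 P.prob_le_1[of "S i \<inter> S k"] by (auto intro: order_trans add_increasing2)
    qed
    also have "\<dots> = n + n\<^sup>2 * (\<beta> + e'\<^sup>2)"
      by (simp add: sum.distrib power2_eq_square algebra_simps)
    finally show ?thesis .
  qed
  have Y_le: "0 \<le> Y x" "Y x \<le> n" for x
  proof -
    have "card (isolated_indices N n x (\<lambda>_. r)) \<le> card {1..n}"
      by (rule card_mono) (auto simp: isolated_indices_def)
    then show "Y x \<le> n" by (simp add: Y_def)
  qed (simp add: Y_def)
  have Y_meas [measurable]: "Y \<in> borel_measurable P"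
    unfolding Y_def[abs_def] P_def by measurable
  have intY: "integrable P Y"
    using Y_le by (intro P.integrable_const_bound[where B = n]) auto
  have intY2: "integrable P (\<lambda>x. (Y x)\<^sup>2)"
    using Y_le by (intro P.integrable_const_bound[where B = "(real n)\<^sup>2"]) (auto intro!: power_mono)
  have "(\<integral>x. (Y x / n - e)\<^sup>2 \<partial>P) = (\<integral>x. (Y x)\<^sup>2 / n\<^sup>2 - (2 * e / n) * Y x + e\<^sup>2 \<partial>P)"
    using n by (intro Bochner_Integration.integral_cong refl) (simp add: power2_eq_square field_simps)
  also have "\<dots> = (\<integral>x. (Y x)\<^sup>2 \<partial>P) / n\<^sup>2 - (2 * e / n) * (\<integral>x. Y x \<partial>P) + e\<^sup>2"
    using intY intY2 by (simp add: P.prob_space)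
  also have "\<dots> = (\<integral>x. (Y x)\<^sup>2 \<partial>P) / n\<^sup>2 - e\<^sup>2"
    using n by (simp add: EY power2_eq_square)
  also have "\<dots> \<le> (n + n\<^sup>2 * (\<beta> + e'\<^sup>2)) / n\<^sup>2 - e\<^sup>2"
    using EY2 by (intro diff_right_mono divide_right_mono) auto
  also have "\<dots> = 1 / n + \<beta> + (e' - e) * (e' + e)"
    using n by (simp add: field_simps power2_eq_square)
  also have "(e' - e) * (e' + e) \<le> \<beta> * 2"
  proof -
    \<comment> \<open>\<open>\<beta>\<close> bounds the balls of radius \<open>2 * r\<close>, which
      contain those of radius \<open>r\<close>.\<close>
    have "prob (norm_ball N y r) \<le> \<beta>" for y
      using finite_measure_mono[of "norm_ball N y r" "norm_ball N y (2 * r)"] \<beta>[of y] r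
      by (force simp: norm_ball_def)
    then have "e' - e \<le> \<beta>" unfolding e_def e'_def by (rule integral_miss_power_diff_le)
    then have "(e' - e) * (e' + e) \<le> \<beta> * (e' + e)" using e01 by (intro mult_right_mono) auto
    also have "\<dots> \<le> \<beta> * 2" using e01 \<beta>0 by (intro mult_left_mono) auto
    finally show ?thesis .
  qed
  finally show ?thesis by (simp add: Y_def e_def P_def)
qed

end

section \<open>Almost sure convergence for deterministic radii\<close>

text \<open>The series of squared deviations has finite expectation, hence converges almost surely
  and its terms vanish, whatever the dependence between different \<open>k\<close>.\<close>

lemma AE_tendsto_of_summable_second_moment:
  fixes Y :: "nat \<Rightarrow> 'b \<Rightarrow> real"
  assumes [measurable]: "\<And>k. Y k \<in> borel_measurable M"
    and int: "\<And>k. integrable M (\<lambda>\<omega>. (Y k \<omega> - c k)\<^sup>2)"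
    and le: "\<And>k. (\<integral>\<omega>. (Y k \<omega> - c k)\<^sup>2 \<partial>M) \<le> b k"
    and b: "summable b" and c: "c \<longlonglongrightarrow> l"
  shows "AE \<omega> in M. (\<lambda>k. Y k \<omega>) \<longlonglongrightarrow> l"
proof -
  have b0: "0 \<le> b k" for k
  proof -
    have "0 \<le> (\<integral>\<omega>. (Y k \<omega> - c k)\<^sup>2 \<partial>M)" by simp
    then show ?thesis using le[of k] by linarith
  qed
  have "(\<integral>\<^sup>+\<omega>. (\<Sum>k. ennreal ((Y k \<omega> - c k)\<^sup>2)) \<partial>M) = (\<Sum>k. \<integral>\<^sup>+\<omega>. ennreal ((Y k \<omega> - c k)\<^sup>2) \<partial>M)"
    by (rule nn_integral_suminf) measurable
  also have "\<dots> \<le> (\<Sum>k. ennreal (b k))"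
  proof (intro suminf_le summableI)
    fix k
    show "(\<integral>\<^sup>+\<omega>. ennreal ((Y k \<omega> - c k)\<^sup>2) \<partial>M) \<le> ennreal (b k)"
      using le[of k] by (subst nn_integral_eq_integral[OF int]) (auto intro: ennreal_leI)
  qed
  also have "\<dots> = ennreal (\<Sum>k. b k)"
    by (rule suminf_ennreal2[OF b0 b])
  also have "\<dots> < \<infinity>" by simp
  finally have "AE \<omega> in M. (\<Sum>k. ennreal ((Y k \<omega> - c k)\<^sup>2)) \<noteq> \<infinity>"
    by (intro nn_integral_PInf_AE) auto
  then show ?thesis
  proof eventually_elim
    case (elim \<omega>)
    then have "(\<lambda>k. (Y k \<omega> - c k)\<^sup>2) \<longlonglongrightarrow> 0"
      by (intro summable_LIMSEQ_zero summable_suminf_not_top) auto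
    then have "(\<lambda>k. Y k \<omega> - c k) \<longlonglongrightarrow> 0"
      using tendsto_real_sqrt[of "\<lambda>k. (Y k \<omega> - c k)\<^sup>2" 0] by (simp add: tendsto_rabs_zero_iff)
    from tendsto_add[OF this c] show ?case by simp
  qed
qed

locale bounded_density =
  fixes f N :: "'a::euclidean_space \<Rightarrow> real"
  assumes N: "is_norm N"
    and f_measurable [measurable]: "f \<in> borel_measurable borel"
    and f_nonneg: "\<And>x. 0 \<le> f x"
    and f_bounded: "bounded (range f)"
    and f_cont: "AE x in lborel. isCont f x"
    and prob_f: "prob_space (density lborel (\<lambda>x. ennreal (f x)))"

sublocale bounded_density \<subseteq> normed_prob_space "density lborel (\<lambda>x. ennreal (f x))" N
  using N prob_f by (simp add: normed_prob_space_def normed_prob_space_axioms_def)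

context bounded_density
begin

abbreviation "D \<equiv> density lborel (\<lambda>x. ennreal (f x))"

definition "unit_volume = measure lborel (norm_ball N 0 1)"

text \<open>Kept as a function of the level \<open>t\<close>, since random radii are compared with
  deterministic levels around \<open>lam\<close>.\<close>

definition "limit_density t = (\<integral>x. exp (- unit_volume * t * f x) * f x \<partial>lborel)"

lemma unit_volume_nonneg: "0 \<le> unit_volume"
  by (simp add: unit_volume_def)

lemma volume_ball: "0 \<le> r \<Longrightarrow> measure lborel (norm_ball N x r) = unit_volume * r ^ DIM('a)"
  unfolding unit_volume_def by (rule measure_norm_ball[OF N])

section \<open>Limit of the expected fraction of isolated points\<close>

lemma integrable_f: "integrable lborel f"
proof -
  have "integrable D (\<lambda>x. 1::real)" by simp
  then show ?thesis by (subst (asm) integrable_real_density) (auto simp: f_nonneg)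
qed

lemma density_bound:
  obtains B where "0 \<le> B" "\<And>x. f x \<le> B"
proof -
  obtain B where "\<And>x. \<bar>f x\<bar> \<le> B" using f_bounded by (auto simp: bounded_iff)
  then show ?thesis using that[of B] f_nonneg by (metis abs_of_nonneg order_trans)
qed

text \<open>Near a continuity point the density stays within \<open>\<epsilon>\<close> of
  \<open>f x\<close>, so the ball probability is \<open>f x\<close> times the volume up to
  \<open>\<epsilon>\<close> times the volume, and \<open>m k\<close> times the volume is
  bounded.\<close>

lemma prob_ball_tendsto:
  fixes m :: "nat \<Rightarrow> nat" and r :: "nat \<Rightarrow> real"
  assumes m: "filterlim m at_top sequentially" and r: "\<And>k. 0 \<le> r k"
    and mr: "(\<lambda>k. m k * r k ^ DIM('a)) \<longlonglongrightarrow> t"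
    and x: "isCont f x"
  shows "(\<lambda>k. m k * prob (norm_ball N x (r k))) \<longlonglongrightarrow> unit_volume * t * f x"
proof -
  \<comment> \<open>\<open>r k ^ DIM('a)\<close> is a convergent sequence divided by
    \<open>m k\<close>, so the radii shrink to zero.\<close>
  have "(\<lambda>k. inverse (real (m k))) \<longlonglongrightarrow> 0"
    using filterlim_compose[OF filterlim_real_sequentially m] by (rule tendsto_inverse_0_at_top)
  from tendsto_mult[OF this mr]
  have "(\<lambda>k. inverse (real (m k)) * (m k * r k ^ DIM('a))) \<longlonglongrightarrow> 0" by simp
  moreover have "\<forall>\<^sub>F k in sequentially. inverse (real (m k)) * (m k * r k ^ DIM('a)) = r k ^ DIM('a)"
    using filterlim_at_top[THEN iffD1, rule_format, OF m, of 1]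
    by eventually_elim simp
  ultimately have "(\<lambda>k. r k ^ DIM('a)) \<longlonglongrightarrow> 0" by (rule Lim_transform_eventually)
  from tendsto_real_root[OF this, of "DIM('a)"] have r0: "r \<longlonglongrightarrow> 0"
    by (simp add: real_root_power_cancel r)
  obtain c where c: "0 < c" "\<And>z. c * norm z \<le> N z" using is_norm_ge_norm[OF N] by blast
  let ?v = "\<lambda>k. unit_volume * (m k * r k ^ DIM('a))"
  have v: "?v \<longlonglongrightarrow> unit_volume * t" by (intro tendsto_intros mr)
  then have "Bseq ?v" using convergentI convergent_imp_Bseq by blast
  then obtain K where K: "0 < K" "\<And>k. \<bar>?v k\<bar> \<le> K" by (auto simp: Bseq_def)
  have "(\<lambda>k. m k * prob (norm_ball N x (r k)) - ?v k * f x) \<longlonglongrightarrow> 0"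
  proof (rule LIMSEQ_I)
    fix e :: real assume e: "0 < e"
    \<comment> \<open>\<open>K\<close> bounds the rescaled volumes \<open>?v k\<close>, so the total
      error will be at most \<open>e / 2\<close>.\<close>
    define \<epsilon> where "\<epsilon> = e / (2 * K)"
    have \<epsilon>: "0 < \<epsilon>" using e K by (simp add: \<epsilon>_def)
    obtain \<delta> where \<delta>: "0 < \<delta>" "\<And>z. dist z x < \<delta> \<Longrightarrow> dist (f z) (f x) < \<epsilon>"
      using x \<epsilon> unfolding continuous_at_eps_delta by blast
    \<comment> \<open>An \<open>N\<close>-ball of radius below \<open>c * \<delta>\<close> lies in
      the Euclidean \<open>\<delta>\<close>-ball where \<open>f\<close> is controlled.\<close>
    have "\<forall>\<^sub>F k in sequentially. r k < c * \<delta>"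
      using c(1) \<delta>(1) by (intro order_tendstoD(2)[OF r0]) simp
    then obtain k0 where k0: "\<And>k. k0 \<le> k \<Longrightarrow> r k < c * \<delta>" by (auto simp: eventually_sequentially)
    have "\<bar>m k * prob (norm_ball N x (r k)) - ?v k * f x\<bar> < e" if k: "k0 \<le> k" for k
    proof -
      let ?A = "norm_ball N x (r k)"
      have near: "\<bar>f z - f x\<bar> \<le> \<epsilon>" if "z \<in> ?A" for z
      proof -
        have "c * norm (z - x) < c * \<delta>"
          using c(2)[of "z - x"] that k0[OF k] by (simp add: norm_ball_def)
        then have "dist z x < \<delta>" using c(1) by (simp add: dist_norm)
        then show ?thesis using \<delta>(2)[of z] by (simp add: dist_real_def)
      qed
      have "(f x - \<epsilon>) * measure lborel ?A \<le> prob ?A"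
        using emeasure_norm_ball_finite[OF N, of x "r k"] norm_ball_borel[OF N] near
        by (intro measure_density_ge) (auto simp: abs_le_iff emeasure_eq_measure algebra_simps)
      moreover have "prob ?A \<le> (f x + \<epsilon>) * measure lborel ?A"
        using emeasure_norm_ball_finite[OF N, of x "r k"] norm_ball_borel[OF N] near \<epsilon> f_nonneg[of x]
        by (intro measure_density_le) (auto simp: abs_le_iff algebra_simps)
      ultimately have "\<bar>prob ?A - unit_volume * r k ^ DIM('a) * f x\<bar> \<le> \<epsilon> * (unit_volume * r k ^ DIM('a))"
        by (simp add: volume_ball r abs_le_iff algebra_simps)
      then have "m k * \<bar>prob ?A - unit_volume * r k ^ DIM('a) * f x\<bar> \<le> m k * (\<epsilon> * (unit_volume * r k ^ DIM('a)))"
        by (rule mult_left_mono) simp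
      moreover have "m k * \<bar>prob ?A - unit_volume * r k ^ DIM('a) * f x\<bar> = \<bar>m k * prob ?A - ?v k * f x\<bar>"
      proof -
        have "m k * prob ?A - ?v k * f x = m k * (prob ?A - unit_volume * r k ^ DIM('a) * f x)"
          by (simp add: algebra_simps)
        then show ?thesis by (simp add: abs_mult)
      qed
      moreover have "m k * (\<epsilon> * (unit_volume * r k ^ DIM('a))) \<le> \<epsilon> * K"
        using K(2)[of k] \<epsilon> by (simp add: mult.left_commute abs_le_iff)
      ultimately have "\<bar>m k * prob ?A - ?v k * f x\<bar> \<le> \<epsilon> * K" by linarith
      also have "\<dots> < e" using e K by (simp add: \<epsilon>_def)
      finally show ?thesis .
    qed
    then show "\<exists>no. \<forall>n\<ge>no. norm (m n * prob (norm_ball N x (r n)) - ?v n * f x - 0) < e" by auto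
  qed
  from tendsto_add[OF this tendsto_mult[OF v tendsto_const[of "f x"]]] show ?thesis by simp
qed

text \<open>Dominated convergence: at continuity points of \<open>f\<close> the powers have the
  exponential limit, and \<open>f\<close> dominates because \<open>miss\<close> is at most
  one.\<close>

lemma integral_miss_tendsto:
  fixes m :: "nat \<Rightarrow> nat" and r :: "nat \<Rightarrow> real"
  assumes m: "filterlim m at_top sequentially" and r: "\<And>k. 0 \<le> r k"
    and mr: "(\<lambda>k. m k * r k ^ DIM('a)) \<longlonglongrightarrow> t"
  shows "(\<lambda>k. \<integral>y. miss (r k) y ^ (m k - 1) \<partial>D) \<longlonglongrightarrow> limit_density t"
proof -
  have eq: "(\<integral>y. miss (r k) y ^ (m k - 1) \<partial>D) = (\<integral>y. miss (r k) y ^ (m k - 1) * f y \<partial>lborel)" for k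
    using f_nonneg by (subst integral_real_density) (auto simp: mult.commute)
  show ?thesis
    unfolding eq limit_density_def
  proof (rule integral_dominated_convergence[where w = f])
    show "AE y in lborel. (\<lambda>k. miss (r k) y ^ (m k - 1) * f y) \<longlonglongrightarrow> exp (- unit_volume * t * f y) * f y"
      using f_cont
    proof eventually_elim
      case (elim y)
      have lim: "(\<lambda>k. m k * prob (norm_ball N y (r k))) \<longlonglongrightarrow> unit_volume * t * f y"
        by (rule prob_ball_tendsto[OF m r mr elim])
      have "(\<lambda>k. inverse (real (m k))) \<longlonglongrightarrow> 0"
        using filterlim_compose[OF filterlim_real_sequentially m] by (rule tendsto_inverse_0_at_top)
      from tendsto_mult[OF this lim]
      have "(\<lambda>k. inverse (real (m k)) * (m k * prob (norm_ball N y (r k)))) \<longlonglongrightarrow> 0" by simp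
      moreover have "\<forall>\<^sub>F k in sequentially.
          inverse (real (m k)) * (m k * prob (norm_ball N y (r k))) = prob (norm_ball N y (r k))"
        using filterlim_at_top[THEN iffD1, rule_format, OF m, of 1]
        by eventually_elim simp
      ultimately have "(\<lambda>k. prob (norm_ball N y (r k))) \<longlonglongrightarrow> 0" by (rule Lim_transform_eventually)
      then have "(\<lambda>k. (1 - prob (norm_ball N y (r k))) ^ (m k - 1)) \<longlonglongrightarrow> exp (- (unit_volume * t * f y))"
        using lim by (intro tendsto_one_minus_power_exp) auto
      then show ?case by (intro tendsto_mult tendsto_const) (simp add: miss_def)
    qed
    show "AE y in lborel. norm (miss (r k) y ^ (m k - 1) * f y) \<le> f y" for k
      using miss_bounds f_nonneg
      by (auto simp: abs_mult power_abs intro!: mult_left_le_one_le power_le_one)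
  qed (auto simp: integrable_f)
qed

lemma prob_ball_le:
  assumes "\<And>x. f x \<le> B" "0 \<le> B" "0 \<le> r"
  shows "prob (norm_ball N y r) \<le> B * unit_volume * r ^ DIM('a)"
proof -
  have "prob (norm_ball N y r) \<le> B * measure lborel (norm_ball N y r)"
    using assms emeasure_norm_ball_finite[OF N] norm_ball_borel[OF N]
    by (intro measure_density_le) auto
  then show ?thesis using assms(3) by (simp add: volume_ball)
qed

text \<open>This continuity lets the tolerance around \<open>lam\<close> shrink at the end; for
  nonnegative levels the exponentials are at most one, so \<open>f\<close> dominates.\<close>

lemma limit_density_tendsto:
  assumes "\<And>k. 0 \<le> s k" "s \<longlonglongrightarrow> t"
  shows "(\<lambda>k. limit_density (s k)) \<longlonglongrightarrow> limit_density t"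
  unfolding limit_density_def
proof (rule integral_dominated_convergence[where w = f])
  show "AE x in lborel. (\<lambda>k. exp (- unit_volume * s k * f x) * f x) \<longlonglongrightarrow> exp (- unit_volume * t * f x) * f x"
    by (intro AE_I2 tendsto_intros assms)
  show "AE x in lborel. norm (exp (- unit_volume * s k * f x) * f x) \<le> f x" for k
    using unit_volume_nonneg assms(1)[of k] f_nonneg by (auto simp: abs_mult intro!: mult_left_le_one_le)
qed (auto simp: integrable_f)

text \<open>Ball probabilities, and with them the variance, are of order \<open>1 / m k\<close>,
  which is summable. The radius is tied to \<open>m k\<close> only asymptotically, so the radius of
  a neighbouring square is admissible.\<close>

lemma AE_isolated_subsequence:
  fixes m :: "nat \<Rightarrow> nat" and r :: "nat \<Rightarrow> real" and X :: "nat \<Rightarrow> 'w \<Rightarrow> 'a"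
  assumes "prob_space M"
    and X: "\<And>i. 1 \<le> i \<Longrightarrow> X i \<in> borel_measurable M"
      "\<And>i. 1 \<le> i \<Longrightarrow> distr M borel (X i) = D"
      "prob_space.indep_vars M (\<lambda>_. borel) X {1..}"
    and m: "filterlim m at_top sequentially" "\<And>k. 0 < m k" "summable (\<lambda>k. 1 / real (m k))"
    and r: "\<And>k. 0 \<le> r k"
    and mr: "(\<lambda>k. m k * r k ^ DIM('a)) \<longlonglongrightarrow> t"
  shows "AE \<omega> in M. (\<lambda>k. card (isolated_indices N (m k) (\<lambda>i. X i \<omega>) (\<lambda>_. r k)) / m k)
    \<longlonglongrightarrow> limit_density t"
proof -
  interpret M: prob_space M by fact
  obtain B where B: "0 \<le> B" "\<And>x. f x \<le> B" using density_bound by blast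
  have "Bseq (\<lambda>k. m k * r k ^ DIM('a))" using mr convergentI convergent_imp_Bseq by blast
  then obtain K where K: "0 < K" "\<And>k. \<bar>m k * r k ^ DIM('a)\<bar> \<le> K" by (auto simp: Bseq_def)
  \<comment> \<open>The factor \<open>2 ^ DIM('a)\<close> accounts for the doubled radius in the
    pair estimate.\<close>
  define C where "C = B * unit_volume * 2 ^ DIM('a) * K"
  have \<beta>: "prob (norm_ball N y (2 * r k)) \<le> C / m k" for y k
  proof -
    have "prob (norm_ball N y (2 * r k)) \<le> B * unit_volume * (2 * r k) ^ DIM('a)"
      using r by (intro prob_ball_le B) simp
    also have "\<dots> = B * unit_volume * 2 ^ DIM('a) * (m k * r k ^ DIM('a)) / m k"
      using m(2)[of k] by (simp add: power_mult_distrib)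
    also have "\<dots> \<le> C / m k"
      unfolding C_def using K(2)[of k] B(1) unit_volume_nonneg
      by (intro divide_right_mono mult_left_mono) auto
    finally show ?thesis .
  qed
  define P where "P k = PiM {1..m k} (\<lambda>_::nat. D)" for k
  define V where "V k \<omega> = (\<lambda>i\<in>{1..m k}. X i \<omega>)" for k \<omega>
  define Z where "Z k x = card (isolated_indices N (m k) x (\<lambda>_. r k)) / m k" for k x
  define c where "c k = (\<integral>y. miss (r k) y ^ (m k - 1) \<partial>D)" for k
  have V_meas: "V k \<in> measurable M (P k)" for k
  proof -
    have "V k \<in> measurable M (PiM {1..m k} (\<lambda>_. borel))"
      unfolding V_def by (intro measurable_restrict X(1)) auto
    moreover have "sets (P k) = sets (PiM {1..m k} (\<lambda>_. borel))"
      unfolding P_def by (intro sets_PiM_cong) (auto simp: sets_D)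
    ultimately show ?thesis using measurable_cong_sets by blast
  qed
  \<comment> \<open>By independence the first \<open>m k\<close> points have the product law, so the
    moment bound transfers to \<open>M\<close>.\<close>
  have V_distr: "distr M (P k) (V k) = P k" for k
  proof -
    have "M.indep_vars (\<lambda>_. borel) X {1..m k}"
      by (rule M.indep_vars_subset[OF X(3)]) auto
    then have "distr M (PiM {1..m k} (\<lambda>_. borel)) (V k) = PiM {1..m k} (\<lambda>i. distr M borel (X i))"
      unfolding V_def using m(2)[of k] X(1)
      by (subst (asm) M.indep_vars_iff_distr_eq_PiM') auto
    also have "\<dots> = P k" unfolding P_def by (intro PiM_cong) (auto simp: X(2))
    finally have "distr M (PiM {1..m k} (\<lambda>_. borel)) (V k) = P k" .
    moreover have "distr M (P k) (V k) = distr M (PiM {1..m k} (\<lambda>_. borel)) (V k)"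
      unfolding P_def by (intro distr_cong sets_PiM_cong refl) (auto simp: sets_D)
    ultimately show ?thesis by simp
  qed
  have Z_meas: "Z k \<in> borel_measurable (P k)" for k
    unfolding Z_def P_def by (intro borel_measurable_divide card_isolated_measurable) auto
  have Z_bounds: "0 \<le> Z k x" "Z k x \<le> 1" for k x
  proof -
    have "card (isolated_indices N (m k) x (\<lambda>_. r k)) \<le> card {1..m k}"
      by (intro card_mono isolated_indices_subset) simp
    then show "Z k x \<le> 1" using m(2)[of k] by (simp add: Z_def)
  qed (simp add: Z_def)
  have c_bounds: "0 \<le> c k" "c k \<le> 1" for k
    by (auto simp: c_def integral_miss_power_bounds)
  have "AE \<omega> in M. (\<lambda>k. Z k (V k \<omega>)) \<longlonglongrightarrow> limit_density t"
  proof (rule AE_tendsto_of_summable_second_moment)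
    show [measurable]: "(\<lambda>\<omega>. Z k (V k \<omega>)) \<in> borel_measurable M" for k
      using measurable_compose[OF V_meas Z_meas] by simp
    have "\<bar>Z k x - c k\<bar>\<^sup>2 \<le> 1" for k x
      using Z_bounds[of k x] c_bounds[of k] by (intro power_le_one) auto
    then show "integrable M (\<lambda>\<omega>. (Z k (V k \<omega>) - c k)\<^sup>2)" for k
      by (intro M.integrable_const_bound[where B = 1]) auto
    show "(\<integral>\<omega>. (Z k (V k \<omega>) - c k)\<^sup>2 \<partial>M) \<le> (1 + 3 * C) * (1 / m k)" for k
    proof -
      have "(\<integral>\<omega>. (Z k (V k \<omega>) - c k)\<^sup>2 \<partial>M) = (\<integral>x. (Z k x - c k)\<^sup>2 \<partial>distr M (P k) (V k))"
        using Z_meas by (intro integral_distr[symmetric] V_meas borel_measurable_power borel_measurable_diff) auto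
      also have "\<dots> \<le> 1 / m k + 3 * (C / m k)"
        unfolding V_distr unfolding Z_def c_def P_def by (rule second_moment_isolated[OF m(2) r \<beta>])
      finally show ?thesis by (simp add: algebra_simps)
    qed
    show "summable (\<lambda>k. (1 + 3 * C) * (1 / m k))" by (intro summable_mult m)
    show "c \<longlonglongrightarrow> limit_density t"
      unfolding c_def by (rule integral_miss_tendsto[OF m(1) r mr])
  qed
  \<comment> \<open>The restriction in \<open>V\<close> is invisible: only indices in
    \<open>{1..m k}\<close> are inspected.\<close>
  moreover have "isolated_indices N (m k) (V k \<omega>) s = isolated_indices N (m k) (\<lambda>i. X i \<omega>) s" for k \<omega> s
    by (auto simp: isolated_indices_def V_def)
  ultimately show ?thesis by (simp add: Z_def)
qed

lemma AE_isolated_fixed_radius: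
  fixes X :: "nat \<Rightarrow> 'w \<Rightarrow> 'a"
  assumes "prob_space M"
    and X: "\<And>i. 1 \<le> i \<Longrightarrow> X i \<in> borel_measurable M"
      "\<And>i. 1 \<le> i \<Longrightarrow> distr M borel (X i) = D"
      "prob_space.indep_vars M (\<lambda>_. borel) X {1..}"
    and t: "0 \<le> t"
  shows "AE \<omega> in M.
    (\<lambda>n. card (isolated_indices N n (\<lambda>i. X i \<omega>) (\<lambda>_. root DIM('a) (t / n))) / n)
      \<longlonglongrightarrow> limit_density t"
proof -
  \<comment> \<open>Division by zero would give radius 0 at \<open>n = 0\<close> and break
    monotonicity for positive \<open>t\<close>; \<open>max 1\<close> avoids this and changes nothing
    for positive \<open>n\<close>.\<close>
  define \<rho> where "\<rho> n = root DIM('a) (t / max 1 (real n))" for n :: nat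
  have \<rho>0: "0 \<le> \<rho> n" for n using t by (simp add: \<rho>_def)
  have \<rho>_pow: "\<rho> n ^ DIM('a) = t / max 1 (real n)" for n
    using t by (simp add: \<rho>_def real_root_pow_pos2)
  have dec: "decseq \<rho>"
    unfolding decseq_def \<rho>_def using t
    by (auto intro!: real_root_le_mono divide_left_mono)
  have sq: "filterlim (\<lambda>k. (k + c)\<^sup>2) at_top sequentially" "summable (\<lambda>k. 1 / real ((k + c)\<^sup>2))"
    for c :: nat
  proof -
    show "filterlim (\<lambda>k. (k + c)\<^sup>2) at_top sequentially"
      unfolding filterlim_at_top
    proof
      fix Z
      show "\<forall>\<^sub>F k in sequentially. Z \<le> (k + c)\<^sup>2"
      proof (rule eventually_sequentiallyI)
        fix k assume "Z \<le> k"
        then have "Z \<le> k + c" by simp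
        then show "Z \<le> (k + c)\<^sup>2" using self_le_power[of "k + c" 2] by (cases "k + c = 0") auto
      qed
    qed
    have "summable (\<lambda>k. inverse (real (k + c) ^ 2))"
      using inverse_power_summable[of 2, where 'a = real] summable_iff_shift[of "\<lambda>k. inverse (real k ^ 2)" c]
      by simp
    then show "summable (\<lambda>k. 1 / real ((k + c)\<^sup>2))" by (simp add: inverse_eq_divide)
  qed
  \<comment> \<open>Taking the radius of the neighbouring square costs a factor tending to one, so
    the level is still \<open>t\<close>.\<close>
  have r1: "(\<lambda>k. real ((k + 1)\<^sup>2) * \<rho> ((k + 2)\<^sup>2) ^ DIM('a)) \<longlonglongrightarrow> t"
  proof -
    have "(\<lambda>k. t * (real (k + 1) ^ 2 / real (k + 2) ^ 2)) \<longlonglongrightarrow> t * 1"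
      by (intro tendsto_mult tendsto_const) real_asymp
    moreover have "max 1 (real ((k + 2)\<^sup>2)) = real (k + 2) ^ 2" for k
      unfolding of_nat_power by (intro max_absorb2 one_le_power) simp
    ultimately show ?thesis unfolding \<rho>_pow by (simp add: mult.commute)
  qed
  have r2: "(\<lambda>k. real ((k + 2)\<^sup>2) * \<rho> ((k + 1)\<^sup>2) ^ DIM('a)) \<longlonglongrightarrow> t"
  proof -
    have "(\<lambda>k. t * (real (k + 2) ^ 2 / real (k + 1) ^ 2)) \<longlonglongrightarrow> t * 1"
      by (intro tendsto_mult tendsto_const) real_asymp
    moreover have "max 1 (real ((k + 1)\<^sup>2)) = real (k + 1) ^ 2" for k
      unfolding of_nat_power by (intro max_absorb2 one_le_power) simp
    ultimately show ?thesis unfolding \<rho>_pow by (simp add: mult.commute)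
  qed
  note AE = AE_isolated_subsequence[OF assms(1) X, where t = t]
  have "AE \<omega> in M. (\<lambda>k. card (isolated_indices N ((k + 1)\<^sup>2) (\<lambda>i. X i \<omega>) (\<lambda>_. \<rho> ((k + 2)\<^sup>2)))
      / real ((k + 1)\<^sup>2)) \<longlonglongrightarrow> limit_density t"
    by (rule AE[where m = "\<lambda>k. (k + 1)\<^sup>2"]) (use sq[of 1] \<rho>0 r1 in auto)
  moreover have "AE \<omega> in M. (\<lambda>k. card (isolated_indices N ((k + 2)\<^sup>2) (\<lambda>i. X i \<omega>) (\<lambda>_. \<rho> ((k + 1)\<^sup>2)))
      / real ((k + 2)\<^sup>2)) \<longlonglongrightarrow> limit_density t"
    by (rule AE[where m = "\<lambda>k. (k + 2)\<^sup>2"]) (use sq[of 2] \<rho>0 r2 in auto)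
  ultimately show ?thesis
  proof eventually_elim
    case (elim \<omega>)
    then have "(\<lambda>n. card (isolated_indices N n (\<lambda>i. X i \<omega>) (\<lambda>_. \<rho> n)) / n) \<longlonglongrightarrow> limit_density t"
      by (intro isolated_indices_interpolation[OF dec]) simp_all
    moreover have "real (card (isolated_indices N n (\<lambda>i. X i \<omega>) (\<lambda>_. \<rho> n)))
        = card (isolated_indices N n (\<lambda>i. X i \<omega>) (\<lambda>_. root DIM('a) (t / n)))" for n
      by (cases n) (simp_all add: \<rho>_def isolated_indices_def max_def)
    ultimately show ?case by simp
  qed
qed

end


section \<open>Random radii\<close>

text \<open>Within a row, Hoeffding's inequality makes an excess of \<open>e / 2\<close> over the
  mean frequency geometrically unlikely. The first Borel-Cantelli lemma then applies under any
  dependence between rows.\<close>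

lemma AE_frequency_eventually_less:
  fixes W :: "nat \<Rightarrow> nat \<Rightarrow> 'b \<Rightarrow> real" and e :: real
  assumes "prob_space M"
    and V: "\<And>n. 1 \<le> n \<Longrightarrow> V n \<in> borel_measurable M"
    and distr_W: "\<And>n i. 1 \<le> i \<Longrightarrow> i \<le> n \<Longrightarrow> distr M borel (W n i) = distr M borel (V n)"
    and indep: "\<And>n. 1 \<le> n \<Longrightarrow> prob_space.indep_vars M (\<lambda>_. borel) (W n) {1..n}"
    and A: "\<And>n. A n \<in> sets borel"
    and lim: "(\<lambda>n. measure M {\<omega> \<in> space M. V n \<omega> \<in> A n}) \<longlonglongrightarrow> 0"
    and e: "0 < e"
  shows "AE \<omega> in M. \<forall>\<^sub>F n in sequentially. real (card {i \<in> {1..n}. W n i \<omega> \<in> A n}) < e * n"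
proof -
  interpret prob_space M by fact
  define F where "F n \<omega> = (\<Sum>i\<in>{1..n}. indicat_real (A n) (W n i \<omega>)) / n" for n \<omega>
  define p where "p n = prob {\<omega> \<in> space M. V n \<omega> \<in> A n}" for n
  \<comment> \<open>Half of \<open>e\<close> is spent on the deviation; the other half covers the
    mean \<open>p n\<close>, which tends to zero.\<close>
  define E where "E n = (if n = 0 then {} else {\<omega> \<in> space M. p n + e / 2 \<le> F n \<omega>})" for n
  have F_eq: "F n \<omega> = card {i \<in> {1..n}. W n i \<omega> \<in> A n} / n" for n \<omega>
  proof -
    have "(\<Sum>i\<in>{1..n}. indicat_real (A n) (W n i \<omega>)) = (\<Sum>i\<in>{1..n}. if W n i \<omega> \<in> A n then 1 else 0)"
      by (intro sum.cong) (auto simp: indicator_def)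
    then show ?thesis by (simp add: F_def sum.If_cases Int_def)
  qed
  have W_meas: "W n i \<in> borel_measurable M" if "1 \<le> i" "i \<le> n" for n i
    using indep[of n] that by (simp add: indep_vars_def)
  have E: "E n \<in> events \<and> prob (E n) \<le> exp (- (e\<^sup>2 / 2)) ^ n" for n
  proof (cases "n = 0")
    case False
    then have n: "1 \<le> n" by simp
    let ?X = "\<lambda>i \<omega>. indicat_real (A n) (W n i \<omega>)" and ?Y = "\<lambda>\<omega>. indicat_real (A n) (V n \<omega>)"
    note [measurable] = V[OF n] A[of n]
    have EY: "expectation ?Y = p n"
    proof -
      have "expectation ?Y = expectation (indicator {\<omega> \<in> space M. V n \<omega> \<in> A n})"
        by (intro Bochner_Integration.integral_cong) (auto simp: indicator_def)
      then show ?thesis by (simp add: p_def Int_absorb2 Collect_restrict)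
    qed
    interpret H: Hoeffding_ineq_iid M "{1..n}" ?X ?Y 0 1 "p n"
    proof unfold_locales
      show "indep_vars (\<lambda>_. borel) ?X {1..n}"
        by (rule indep_vars_compose2[OF indep[OF n]]) measurable
      show "distr M borel (?X i) = distr M borel ?Y" if "i \<in> {1..n}" for i
      proof -
        have [measurable]: "W n i \<in> borel_measurable M" using that by (intro W_meas) auto
        have "distr M borel (?X i) = distr (distr M borel (W n i)) borel (indicat_real (A n))"
          by (subst distr_distr) (auto simp: comp_def)
        also have "\<dots> = distr (distr M borel (V n)) borel (indicat_real (A n))"
          using that distr_W[of i n] by simp
        also have "\<dots> = distr M borel ?Y"
          by (subst distr_distr) (auto simp: comp_def)
        finally show ?thesis .
      qed
      show "p n \<equiv> expectation ?Y" by (simp add: EY)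
    qed (auto simp: indicator_def)
    have "prob {\<omega> \<in> space M. (\<Sum>i\<in>{1..n}. ?X i \<omega>) / card {1..n} \<ge> p n + e / 2}
        \<le> exp (- 2 * real (card {1..n}) * (e / 2)\<^sup>2 / (1 - 0)\<^sup>2)"
      using e n by (intro H.Hoeffding_ineq_ge') auto
    then have "prob (E n) \<le> exp (- 2 * real n * (e / 2)\<^sup>2)"
      using n by (simp add: E_def F_def)
    also have "\<dots> = exp (- (e\<^sup>2 / 2)) ^ n"
      by (simp add: exp_of_nat_mult[symmetric] power2_eq_square)
    finally have "prob (E n) \<le> exp (- (e\<^sup>2 / 2)) ^ n" .
    moreover have "E n \<in> events"
    proof -
      have "(\<lambda>\<omega>. ?X i \<omega>) \<in> borel_measurable M" if "i \<in> {1..n}" for i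
        using that measurable_compose[OF W_meas borel_measurable_indicator[OF A]] by auto
      then have [measurable]: "F n \<in> borel_measurable M" unfolding F_def by measurable
      show ?thesis using n unfolding E_def by simp
    qed
    ultimately show ?thesis by simp
  qed (simp add: E_def)
  have "AE \<omega> in M. \<forall>\<^sub>F n in sequentially. \<omega> \<in> space M - E n"
  proof (rule borel_cantelli_AE1)
    have "exp (- (e\<^sup>2 / 2)) < 1" using e by simp
    then have "summable (\<lambda>n. exp (- (e\<^sup>2 / 2)) ^ n)" by (intro summable_geometric) simp
    then show "summable (\<lambda>n. prob (E n))"
      by (rule summable_comparison_test[rotated]) (use E in auto)
  qed (use E in \<open>auto simp: less_top[symmetric]\<close>)
  then show ?thesis
  proof eventually_elim
    case (elim \<omega>)
    have "\<forall>\<^sub>F n in sequentially. p n < e / 2"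
      using e by (intro order_tendstoD(2)[OF lim[folded p_def]]) simp
    then show ?case
      using elim eventually_gt_at_top[of 0]
    proof eventually_elim
      case (elim n)
      then have "F n \<omega> < e" by (auto simp: E_def not_le)
      then show ?case using elim(3) by (simp add: F_eq divide_less_eq)
    qed
  qed
qed

section \<open>Squeezing random radii between deterministic ones\<close>

theorem theorem2:
  fixes M :: "'w measure"
    and N :: "real ^ 'd \<Rightarrow> real"
    and f :: "real ^ 'd \<Rightarrow> real"
    and q :: "nat \<Rightarrow> real \<Rightarrow> real"
    and X :: "nat \<Rightarrow> 'w \<Rightarrow> real ^ 'd"
    and R :: "nat \<Rightarrow> 'w \<Rightarrow> real"
    and Rcopy :: "nat \<Rightarrow> nat \<Rightarrow> 'w \<Rightarrow> real"
    and lam \<theta> :: real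
  assumes "prob_space M"
    and "is_norm N"
    \<comment> \<open>the density \<open>f\<close>\<close>
    and "\<And>x. 0 \<le> f x"
    and "bounded (range f)"
    and "AE x in lborel. isCont f x"
    \<comment> \<open>\<open>X 1, X 2, \<dots>\<close> are i.i.d. with density \<open>f\<close>\<close>
    and "\<And>i. 1 \<le> i \<Longrightarrow> distributed M lborel (X i) (\<lambda>x. ennreal (f x))"
    and "prob_space.indep_vars M (\<lambda>_. borel) X {1..}"
    \<comment> \<open>\<open>R n\<close> is positive and has density \<open>q n\<close>\<close>
    and "\<And>n r. 1 \<le> n \<Longrightarrow> 0 \<le> q n r"
    and "\<And>n. 1 \<le> n \<Longrightarrow> distributed M lborel (R n) (\<lambda>r. ennreal (q n r))"
    and "\<And>n. 1 \<le> n \<Longrightarrow> AE \<omega> in M. 0 < R n \<omega>"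
    \<comment> \<open>\<open>Rcopy n 1, \<dots>, Rcopy n n\<close> are independent copies of \<open>R n\<close>, independent of \<open>X 1, X 2, \<dots>\<close>;
        nothing is assumed about the joint law for different \<open>n\<close>\<close>
    and "\<And>n i. 1 \<le> i \<Longrightarrow> i \<le> n \<Longrightarrow> distr M borel (Rcopy n i) = distr M borel (R n)"
    and "\<And>n. 1 \<le> n \<Longrightarrow> prob_space.indep_vars M (\<lambda>_. borel) (Rcopy n) {1..n}"
    and "\<And>n. 1 \<le> n \<Longrightarrow>
           indep_pair M
             (Pi\<^sub>M {1..} (\<lambda>_. borel)) (\<lambda>\<omega>. \<lambda>i\<in>{1..}. X i \<omega>)
             (Pi\<^sub>M {1..n} (\<lambda>_. borel)) (\<lambda>\<omega>. \<lambda>i\<in>{1..n}. Rcopy n i \<omega>)"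
    and "(\<lambda>n. \<integral>\<^sup>+ \<omega>. ennreal (R n \<omega> ^ CARD('d)) \<partial>M) \<longlonglongrightarrow> 0"
    and "0 \<le> lam"
    and "tends_in_prob M (\<lambda>n \<omega>. real n * R n \<omega> ^ CARD('d)) lam"
    and "\<theta> = measure lborel (norm_ball N 0 1)"
  shows "AE \<omega> in M.
           (\<lambda>n. real (num_isolated single_vertex
                        (geometric_digraph N n (\<lambda>i. X i \<omega>) (\<lambda>i. Rcopy n i \<omega>))) / real n)
           \<longlonglongrightarrow> (\<integral>x. exp (- \<theta> * lam * f x) * f x \<partial>lborel)"
proof -
  interpret M: prob_space M by fact
  have f_meas: "f \<in> borel_measurable borel"
    using distributed_real_measurable[OF _ assms(6)[of 1]] assms(3) by simp
  have X_meas: "X i \<in> borel_measurable M" if "1 \<le> i" for i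
    using distributed_measurable[OF assms(6)[OF that]] by simp
  have X_distr: "distr M borel (X i) = density lborel (\<lambda>x. ennreal (f x))" if "1 \<le> i" for i
  proof -
    have "distr M borel (X i) = distr M lborel (X i)" by (rule distr_cong) auto
    then show ?thesis using distributed_distr_eq_density[OF assms(6)[OF that]] by simp
  qed
  interpret bounded_density f N
  proof (rule bounded_density.intro)
    show "prob_space (density lborel (\<lambda>x. ennreal (f x)))"
      using M.prob_space_distr[OF X_meas[of 1]] X_distr[of 1] by simp
  qed (use assms(2-5) f_meas in auto)
  define L where "L = limit_density"
  define I where "I n r \<omega> = real (card (isolated_indices N n (\<lambda>i. X i \<omega>) r))" for n r \<omega>
  define \<rho> where "\<rho> t n = root CARD('d) (t / real n)" for t n
  \<comment> \<open>Countably many tolerances, so that the almost sure statements hold for all of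
    them at once.\<close>
  define \<delta> where "\<delta> j = 1 / real (Suc j)" for j
  \<comment> \<open>The exceptional radii: convergence in probability says that \<open>R n\<close>
    falls into \<open>A j n\<close> with vanishing probability.\<close>
  define A where "A j n = {s. \<delta> j < \<bar>real n * s ^ CARD('d) - lam\<bar>}" for j n
  have \<delta>: "0 < \<delta> j" for j by (simp add: \<delta>_def)
  have \<delta>_lim: "\<delta> \<longlonglongrightarrow> 0"
    unfolding \<delta>_def using LIMSEQ_inverse_real_of_nat by (simp add: inverse_eq_divide)
  have L_up: "(\<lambda>j. L (lam + \<delta> j)) \<longlonglongrightarrow> L lam"
    unfolding L_def using \<delta> assms(15) tendsto_add[OF tendsto_const \<delta>_lim, of lam]
    by (intro limit_density_tendsto) (auto intro: add_nonneg_nonneg less_imp_le)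
  \<comment> \<open>The truncation keeps the lower level admissible when
    \<open>lam - \<delta> j\<close> is negative.\<close>
  have L_lo: "(\<lambda>j. L (max 0 (lam - \<delta> j))) \<longlonglongrightarrow> L lam"
    unfolding L_def using assms(15) tendsto_max[OF tendsto_const tendsto_diff[OF tendsto_const \<delta>_lim], of 0 lam]
    by (intro limit_density_tendsto) auto
  have fixed: "AE \<omega> in M. (\<lambda>n. I n (\<lambda>_. \<rho> t n) \<omega> / n) \<longlonglongrightarrow> L t" if "0 \<le> t" for t
    using AE_isolated_fixed_radius[OF assms(1) X_meas X_distr assms(7) that]
    by (simp add: I_def \<rho>_def L_def)
  have bad: "AE \<omega> in M. \<forall>\<^sub>F n in sequentially. real (card {i \<in> {1..n}. Rcopy n i \<omega> \<in> A j n}) < \<delta> j * n"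
    for j
  proof (rule AE_frequency_eventually_less[OF assms(1) _ assms(11,12)])
    show "R n \<in> borel_measurable M" if "1 \<le> n" for n
      using distributed_measurable[OF assms(9)[OF that]] by simp
    show "A j n \<in> sets borel" for n unfolding A_def by measurable
    show "(\<lambda>n. measure M {\<omega> \<in> space M. R n \<omega> \<in> A j n}) \<longlonglongrightarrow> 0"
      using assms(16) \<delta>[of j] unfolding tends_in_prob_def A_def by simp
  qed (use \<delta> in auto)
  \<comment> \<open>Positivity is a property of the law and so passes from \<open>R n\<close> to its
    copies.\<close>
  have pos: "AE \<omega> in M. 1 \<le> i \<longrightarrow> i \<le> n \<longrightarrow> 0 < Rcopy n i \<omega>" for n i
  proof (cases "1 \<le> i \<and> i \<le> n")
    case True
    then have n: "1 \<le> n" by simp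
    have meas: "R n \<in> borel_measurable M" "Rcopy n i \<in> borel_measurable M"
      using distributed_measurable[OF assms(9)[OF n]] assms(12)[OF n] True
      by (auto simp: M.indep_vars_def)
    have eq: "distr M borel (Rcopy n i) = distr M borel (R n)" using assms(11) True by blast
    have "AE s in distr M borel (Rcopy n i). 0 < s"
      unfolding eq using assms(10)[OF n] meas(1) by (subst AE_distr_iff) auto
    then have "AE \<omega> in M. 0 < Rcopy n i \<omega>" using meas(2) by (subst (asm) AE_distr_iff) auto
    then show ?thesis by eventually_elim simp
  qed auto
  have "AE \<omega> in M. \<forall>j. (\<lambda>n. I n (\<lambda>_. \<rho> (lam + \<delta> j) n) \<omega> / n) \<longlonglongrightarrow> L (lam + \<delta> j)"
    unfolding AE_all_countable using assms(15) less_imp_le[OF \<delta>] by (intro allI fixed add_nonneg_nonneg)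
  moreover have "AE \<omega> in M. \<forall>j. (\<lambda>n. I n (\<lambda>_. \<rho> (max 0 (lam - \<delta> j)) n) \<omega> / n)
      \<longlonglongrightarrow> L (max 0 (lam - \<delta> j))"
    unfolding AE_all_countable by (auto intro!: fixed)
  moreover have "AE \<omega> in M. \<forall>j. \<forall>\<^sub>F n in sequentially.
      real (card {i \<in> {1..n}. Rcopy n i \<omega> \<in> A j n}) < \<delta> j * n"
    unfolding AE_all_countable using bad by blast
  moreover have "AE \<omega> in M. \<forall>n i. 1 \<le> i \<longrightarrow> i \<le> n \<longrightarrow> 0 < Rcopy n i \<omega>"
    unfolding AE_all_countable using pos by blast
  ultimately have "AE \<omega> in M.
      (\<lambda>n. real (num_isolated single_vertex
        (geometric_digraph N n (\<lambda>i. X i \<omega>) (\<lambda>i. Rcopy n i \<omega>))) / real n) \<longlonglongrightarrow> L lam"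
  proof eventually_elim
    case (elim \<omega>)
    define G where "G n = I n (\<lambda>i. Rcopy n i \<omega>) \<omega>" for n
    define bad where "bad j n = real (card {i \<in> {1..n}. Rcopy n i \<omega> \<in> A j n})" for j n
    have \<rho>_less: "s < \<rho> t n \<longleftrightarrow> n * s ^ CARD('d) < t" "\<rho> t n < s \<longleftrightarrow> t < n * s ^ CARD('d)"
      if "0 < n" "0 < s" "0 \<le> t" for n s t
    proof -
      have s: "root CARD('d) (s ^ CARD('d)) = s"
        using that by (intro real_root_power_cancel) auto
      have "s < \<rho> t n \<longleftrightarrow> s ^ CARD('d) < t / n"
        unfolding \<rho>_def by (subst (1) s[symmetric]) (rule real_root_less_iff, simp)
      then show "s < \<rho> t n \<longleftrightarrow> n * s ^ CARD('d) < t"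
        using that by (simp add: less_divide_eq mult.commute)
      have "\<rho> t n < s \<longleftrightarrow> t / n < s ^ CARD('d)"
        unfolding \<rho>_def by (subst (1) s[symmetric]) (rule real_root_less_iff, simp)
      then show "\<rho> t n < s \<longleftrightarrow> t < n * s ^ CARD('d)"
        using that by (simp add: divide_less_eq mult.commute)
    qed
    \<comment> \<open>Only radii below the lower level can add isolated points. Such a radius is
      positive, so the maximum must be \<open>lam - \<delta> j\<close> and the radius is
      exceptional.\<close>
    have up: "G n \<le> I n (\<lambda>_. \<rho> (max 0 (lam - \<delta> j)) n) \<omega> + bad j n" if n: "0 < n" for n j
    proof -
      have "{i \<in> {1..n}. Rcopy n i \<omega> < \<rho> (max 0 (lam - \<delta> j)) n} \<subseteq> {i \<in> {1..n}. Rcopy n i \<omega> \<in> A j n}"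
      proof clarify
        fix i assume i: "i \<in> {1..n}" and less: "Rcopy n i \<omega> < \<rho> (max 0 (lam - \<delta> j)) n"
        have pos: "0 < Rcopy n i \<omega>" using elim(4) i by auto
        then have "0 < n * Rcopy n i \<omega> ^ CARD('d)" using n by simp
        moreover have "n * Rcopy n i \<omega> ^ CARD('d) < max 0 (lam - \<delta> j)"
          using \<rho>_less(1)[OF n pos] less by simp
        ultimately have "n * Rcopy n i \<omega> ^ CARD('d) < lam - \<delta> j" by linarith
        then show "Rcopy n i \<omega> \<in> A j n" by (auto simp: A_def)
      qed
      then have "card {i \<in> {1..n}. Rcopy n i \<omega> < \<rho> (max 0 (lam - \<delta> j)) n}
          \<le> card {i \<in> {1..n}. Rcopy n i \<omega> \<in> A j n}"
        by (intro card_mono) auto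
      then show ?thesis
        using card_isolated_indices_le_add[of N n "\<lambda>i. X i \<omega>" "\<lambda>i. Rcopy n i \<omega>"
            "\<lambda>_. \<rho> (max 0 (lam - \<delta> j)) n"]
        unfolding G_def I_def bad_def by linarith
    qed
    have lo: "I n (\<lambda>_. \<rho> (lam + \<delta> j) n) \<omega> \<le> G n + bad j n" if n: "0 < n" for n j
    proof -
      have "{i \<in> {1..n}. \<rho> (lam + \<delta> j) n < Rcopy n i \<omega>} \<subseteq> {i \<in> {1..n}. Rcopy n i \<omega> \<in> A j n}"
      proof clarify
        fix i assume i: "i \<in> {1..n}" and "\<rho> (lam + \<delta> j) n < Rcopy n i \<omega>"
        moreover have "0 < Rcopy n i \<omega>" using elim(4) i by auto
        ultimately have "lam + \<delta> j < n * Rcopy n i \<omega> ^ CARD('d)"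
          using \<rho>_less(2)[OF n, of "Rcopy n i \<omega>" "lam + \<delta> j"] assms(15) \<delta>[of j] by auto
        then show "Rcopy n i \<omega> \<in> A j n" by (auto simp: A_def)
      qed
      then have "card {i \<in> {1..n}. \<rho> (lam + \<delta> j) n < Rcopy n i \<omega>}
          \<le> card {i \<in> {1..n}. Rcopy n i \<omega> \<in> A j n}"
        by (intro card_mono) auto
      then show ?thesis
        using card_isolated_indices_le_add[of N n "\<lambda>i. X i \<omega>" "\<lambda>_. \<rho> (lam + \<delta> j) n"
            "\<lambda>i. Rcopy n i \<omega>"]
        unfolding G_def I_def bad_def by linarith
    qed
    have "(\<lambda>n. G n / n) \<longlonglongrightarrow> L lam"
    proof (rule tendstoI)
      fix e :: real assume "0 < e"
      then have e: "0 < e / 3" by simp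
      \<comment> \<open>The error splits into the exceptional fraction, the deviation at a fixed
        level and the change of limit between levels. First \<open>j\<close> is fixed, then
        \<open>n\<close> grows.\<close>
      have "\<forall>\<^sub>F j in sequentially. \<delta> j < e / 3 \<and> dist (L (lam + \<delta> j)) (L lam) < e / 3
          \<and> dist (L (max 0 (lam - \<delta> j))) (L lam) < e / 3"
        using order_tendstoD(2)[OF \<delta>_lim e] tendstoD[OF L_up e] tendstoD[OF L_lo e]
        by eventually_elim simp
      then obtain j where j: "\<delta> j < e / 3" "dist (L (lam + \<delta> j)) (L lam) < e / 3"
          "dist (L (max 0 (lam - \<delta> j))) (L lam) < e / 3"
        using eventually_happens'[OF sequentially_bot] by blast
      have "\<forall>\<^sub>F n in sequentially. dist (I n (\<lambda>_. \<rho> (lam + \<delta> j) n) \<omega> / n) (L (lam + \<delta> j)) < e / 3"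
        "\<forall>\<^sub>F n in sequentially. dist (I n (\<lambda>_. \<rho> (max 0 (lam - \<delta> j)) n) \<omega> / n)
          (L (max 0 (lam - \<delta> j))) < e / 3"
        "\<forall>\<^sub>F n in sequentially. bad j n < \<delta> j * n"
        using tendstoD[OF elim(1)[rule_format] e] tendstoD[OF elim(2)[rule_format] e] elim(3)
        unfolding bad_def by blast+
      then show "\<forall>\<^sub>F n in sequentially. dist (G n / n) (L lam) < e"
        using eventually_gt_at_top[of 0]
      proof eventually_elim
        case (elim n)
        have "bad j n / n < \<delta> j"
          using elim(3,4) by (simp add: divide_less_eq)
        then have "bad j n / n < e / 3"
          using j(1) by (rule less_trans)
        moreover have "G n / n \<le> I n (\<lambda>_. \<rho> (max 0 (lam - \<delta> j)) n) \<omega> / n + bad j n / n"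
          using divide_right_mono[OF up[OF elim(4), of j], of n] by (simp add: add_divide_distrib)
        moreover have "I n (\<lambda>_. \<rho> (lam + \<delta> j) n) \<omega> / n \<le> G n / n + bad j n / n"
          using divide_right_mono[OF lo[OF elim(4), of j], of n] by (simp add: add_divide_distrib)
        ultimately show ?case
          using elim(1,2) j(2,3) unfolding dist_real_def by linarith
      qed
    qed
    moreover have "num_isolated single_vertex
        (geometric_digraph N n (\<lambda>i. X i \<omega>) (\<lambda>i. Rcopy n i \<omega>))
        = card (isolated_indices N n (\<lambda>i. X i \<omega>) (\<lambda>i. Rcopy n i \<omega>))" for n
      using elim(4) by (intro num_isolated_geometric_digraph assms(2)) auto
    ultimately show ?case by (simp add: G_def I_def)
  qed
  then show ?thesis
    by (simp add: L_def limit_density_def unit_volume_def assms(17))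
qed

end
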